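(* Let $n>1$ be an integer, let $K$ be a field, and let $R_n$ be the cyclotomic KLR algebra over $K$ defined in the context. The number of ${\bf i}\in I_n$ satisfying ${\bf e}({\bf i})\neq 0$ in $R_n$ is exactly $2^{n-2}$. Moreover, the set of all such nonzero elements ${\bf e}({\bf i})$ is a complete set of primitive orthogonal idempotents of $R_n$.
   Context: Let $K$ be a field and $n>1$ an integer. The quiver $A_n^{(1)}$ (in this paper's indexing) has vertices $\{0,1,\dots,n-1\}$ and arrows $i\to i+1$ for $0\le i\le n-2$ together with $n-1\to 0$. (For $n=2$ there is an arrow in each direction between $0$ and $1$.) Let $I_n$ be the set of all permutations ${\bf i}=(i_1,\dots,i_n)$ of $(0,1,\dots,n-1)$. For $1\le k\le n-1$, $s_k\cdot{\bf i}$ is ${\bf i}$ with the entries $i_k,i_{k+1}$ interchanged. For vertices $i\ne j$: $i\not\leftrightarrow j$ means there is no arrow between them; $i\to j$ means there is an arrow from $i$ to $j$ only; $i\leftarrow j$ means there is an arrow from $j$ to $i$ only; $i\leftrightarrow j$ means there are arrows both ways. The KLR algebra $R_n(\alpha)$ (for $\alpha=\sum_{i}\alpha_i$, the sum over all vertices) is the unital associative $K$-algebra with generators ${\bf e}({\bf i})$ (${\bf i}\in I_n$), $y_1,\dots,y_n$, $\psi_1,\dots,\psi_{n-1}$ and relations, for all indices and ${\bf i},{\bf j}\in I_n$ for which they make sense: ${\bf e}({\bf i}){\bf e}({\bf j})=\delta_{{\bf i},{\bf j}}{\bf e}({\bf i})$; $\sum_{{\bf i}\in I_n}{\bf e}({\bf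 i})=1$; $y_k{\bf e}({\bf i})={\bf e}({\bf i})y_k$; $\psi_k{\bf e}({\bf i})={\bf e}(s_k\cdot{\bf i})\psi_k$; $y_ky_l=y_ly_k$; $\psi_ky_l=y_l\psi_k$ for $l\ne k,k+1$; $\psi_k\psi_l=\psi_l\psi_k$ for $|k-l|>1$; $\psi_ky_{k+1}{\bf e}({\bf i})=y_k\psi_k{\bf e}({\bf i})$; $y_{k+1}\psi_k{\bf e}({\bf i})=\psi_ky_k{\bf e}({\bf i})$; $\psi_k\psi_{k+1}\psi_k{\bf e}({\bf i})=\psi_{k+1}\psi_k\psi_{k+1}{\bf e}({\bf i})$; and $\psi_k^2{\bf e}({\bf i})$ equals ${\bf e}({\bf i})$ if $i_k\not\leftrightarrow i_{k+1}$; $(y_{k+1}-y_k){\bf e}({\bf i})$ if $i_k\to i_{k+1}$; $(y_k-y_{k+1}){\bf e}({\bf i})$ if $i_k\leftarrow i_{k+1}$; $(y_{k+1}-y_k)(y_k-y_{k+1}){\bf e}({\bf i})$ if $i_k\leftrightarrow i_{k+1}$. The cyclotomic ideal $I^{\Lambda}$ (for $\Lambda=\Lambda_0$) is the two-sided ideal of $R_n(\alpha)$ generated by $\{y_1{\bf e}({\bf i}) : {\bf i}\in I_n,\ i_1=0\}\cup\{{\bf e}({\bf i}) : {\bf i}\in I_n,\ i_1\ne 0\}$, and $R_n=R_n(\alpha)/I^{\Lambda}$. The images of the generators in $R_n$ are denoted by the same symbols. *)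

theory Defs
  imports
    "HOL-Algebra.QuotRing"
    "HOL-Library.Poly_Mapping"
    "HOL-Combinatorics.Multiset_Permutations"
begin

text \<open>The quiver with vertices \<open>{0..<n}\<close>. For \<open>n = 2\<close> there is an arrow in each direction.\<close>

definition arrow :: "nat \<Rightarrow> nat \<Rightarrow> nat \<Rightarrow> bool" where
  "arrow n i j \<longleftrightarrow> (i + 1 < n \<and> j = i + 1) \<or> (i = n - 1 \<and> j = 0)"

text \<open>The entry \<open>i\<^sub>k\<close> of a sequence, with \<open>k\<close> counted from 1.\<close>

definition entry :: "nat list \<Rightarrow> nat \<Rightarrow> nat" where
  "entry i k = i ! (k - 1)"

definition swap_entries :: "nat \<Rightarrow> nat list \<Rightarrow> nat list" where
  "swap_entries k i = i[k - 1 := entry i (k + 1), k := entry i k]"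

abbreviation residue_seqs :: "nat \<Rightarrow> nat list set" where
  "residue_seqs n \<equiv> permutations_of_set {0..<n}"

subsection \<open>The free algebra on the generators\<close>

datatype klr_gen = GenE "nat list" | GenY nat | GenPsi nat

text \<open>Words are wrapped in a type of their own, so that concatenation can be the additive
  monoid structure that the convolution product on \<open>poly_mapping\<close> requires.\<close>

datatype klr_word = Word (letters: "klr_gen list")

instantiation klr_word :: monoid_add
begin

definition zero_klr_word :: klr_word where
  "0 = Word []"

definition plus_klr_word :: "klr_word \<Rightarrow> klr_word \<Rightarrow> klr_word" where
  "u + v = Word (letters u @ letters v)"

instance
  by standard (simp_all add: zero_klr_word_def plus_klr_word_def)

end

definition klr_gens :: "nat \<Rightarrow> klr_gen set" where
  "klr_gens n = GenE ` residue_seqs n \<union> GenY ` {1..n} \<union> GenPsi ` {1..n - 1}"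

type_synonym 'k free_elem = "klr_word \<Rightarrow>\<^sub>0 'k"

definition klr_free :: "'k::field itself \<Rightarrow> nat \<Rightarrow> 'k free_elem ring" where
  "klr_free K n =
     \<lparr>carrier = {p. \<forall>w \<in> Poly_Mapping.keys p. set (letters w) \<subseteq> klr_gens n},
      monoid.mult = (*), one = 1, zero = 0, add = (+)\<rparr>"

definition gen :: "klr_gen \<Rightarrow> 'k::field free_elem" where
  "gen g = Poly_Mapping.single (Word [g]) 1"

abbreviation fe :: "nat list \<Rightarrow> 'k::field free_elem" where
  "fe i \<equiv> gen (GenE i)"

abbreviation fy :: "nat \<Rightarrow> 'k::field free_elem" where
  "fy k \<equiv> gen (GenY k)"

abbreviation fpsi :: "nat \<Rightarrow> 'k::field free_elem" where
  "fpsi k \<equiv> gen (GenPsi k)"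

lemma klr_free_simps [simp]:
  "monoid.mult (klr_free K n) = (*)" "one (klr_free K n) = 1"
  "zero (klr_free K n) = 0" "add (klr_free K n) = (+)"
  by (simp_all add: klr_free_def)

lemma klr_free_mult_closed:
  assumes "p \<in> carrier (klr_free K n)" "q \<in> carrier (klr_free K n)"
  shows "p * q \<in> carrier (klr_free K n)"
proof -
  have "set (letters w) \<subseteq> klr_gens n" if w: "w \<in> Poly_Mapping.keys (p * q)" for w
  proof -
    obtain u v where "u \<in> Poly_Mapping.keys p" "v \<in> Poly_Mapping.keys q" "w = u + v"
      using w Poly_Mapping.keys_mult[of p q] by blast
    then show ?thesis
      using assms by (auto simp: klr_free_def plus_klr_word_def)
  qed
  then show ?thesis by (auto simp: klr_free_def)
qed

lemma klr_free_add_closed: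
  assumes "p \<in> carrier (klr_free K n)" "q \<in> carrier (klr_free K n)"
  shows "p + q \<in> carrier (klr_free K n)"
  using assms Poly_Mapping.keys_add[of p q] by (fastforce simp: klr_free_def)

lemma klr_free_uminus_closed:
  "p \<in> carrier (klr_free K n) \<Longrightarrow> - p \<in> carrier (klr_free K n)"
  by (simp add: klr_free_def)

lemma ring_klr_free: "ring (klr_free K n)"
proof (rule ringI)
  show "abelian_group (klr_free K n)"
  proof (rule abelian_groupI)
    fix p assume "p \<in> carrier (klr_free K n)"
    then show "\<exists>q\<in>carrier (klr_free K n). q \<oplus>\<^bsub>klr_free K n\<^esub> p = \<zero>\<^bsub>klr_free K n\<^esub>"
      by (intro bexI[of _ "- p"]) (simp_all add: klr_free_uminus_closed)
  qed (auto simp: klr_free_add_closed add.assoc add.commute, simp add: klr_free_def)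
  show "monoid (klr_free K n)"
    by (rule monoidI)
      (auto simp: klr_free_mult_closed mult.assoc, simp add: klr_free_def zero_klr_word_def)
qed (auto simp: distrib_left distrib_right)

subsection \<open>The KLR algebra and its cyclotomic quotient\<close>

text \<open>A relation \<open>l = r\<close> is represented by the element \<open>l - r\<close> of the free algebra.\<close>

inductive_set klr_rels :: "nat \<Rightarrow> 'k::field free_elem set" for n :: nat where
  e_e: "\<lbrakk>i \<in> residue_seqs n; j \<in> residue_seqs n\<rbrakk>
    \<Longrightarrow> fe i * fe j - (if i = j then fe i else 0) \<in> klr_rels n"
| e_sum: "(\<Sum>i\<in>residue_seqs n. fe i) - 1 \<in> klr_rels n"
| y_e: "\<lbrakk>k \<in> {1..n}; i \<in> residue_seqs n\<rbrakk> \<Longrightarrow> fy k * fe i - fe i * fy k \<in> klr_rels n"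
| psi_e: "\<lbrakk>k \<in> {1..n - 1}; i \<in> residue_seqs n\<rbrakk>
    \<Longrightarrow> fpsi k * fe i - fe (swap_entries k i) * fpsi k \<in> klr_rels n"
| y_y: "\<lbrakk>k \<in> {1..n}; l \<in> {1..n}\<rbrakk> \<Longrightarrow> fy k * fy l - fy l * fy k \<in> klr_rels n"
| psi_y: "\<lbrakk>k \<in> {1..n - 1}; l \<in> {1..n}; l \<noteq> k; l \<noteq> k + 1\<rbrakk>
    \<Longrightarrow> fpsi k * fy l - fy l * fpsi k \<in> klr_rels n"
| psi_psi: "\<lbrakk>k \<in> {1..n - 1}; l \<in> {1..n - 1}; \<bar>int k - int l\<bar> > 1\<rbrakk>
    \<Longrightarrow> fpsi k * fpsi l - fpsi l * fpsi k \<in> klr_rels n"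
| psi_y_right: "\<lbrakk>k \<in> {1..n - 1}; i \<in> residue_seqs n\<rbrakk>
    \<Longrightarrow> fpsi k * fy (k + 1) * fe i - fy k * fpsi k * fe i \<in> klr_rels n"
| y_psi_right: "\<lbrakk>k \<in> {1..n - 1}; i \<in> residue_seqs n\<rbrakk>
    \<Longrightarrow> fy (k + 1) * fpsi k * fe i - fpsi k * fy k * fe i \<in> klr_rels n"
| braid: "\<lbrakk>k \<in> {1..n - 1}; k + 1 \<in> {1..n - 1}; i \<in> residue_seqs n\<rbrakk>
    \<Longrightarrow> fpsi k * fpsi (k + 1) * fpsi k * fe i
        - fpsi (k + 1) * fpsi k * fpsi (k + 1) * fe i \<in> klr_rels n"
| psi_sq_none: "\<lbrakk>k \<in> {1..n - 1}; i \<in> residue_seqs n;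
      \<not> arrow n (entry i k) (entry i (k + 1)); \<not> arrow n (entry i (k + 1)) (entry i k)\<rbrakk>
    \<Longrightarrow> fpsi k * fpsi k * fe i - fe i \<in> klr_rels n"
| psi_sq_right: "\<lbrakk>k \<in> {1..n - 1}; i \<in> residue_seqs n;
      arrow n (entry i k) (entry i (k + 1)); \<not> arrow n (entry i (k + 1)) (entry i k)\<rbrakk>
    \<Longrightarrow> fpsi k * fpsi k * fe i - (fy (k + 1) - fy k) * fe i \<in> klr_rels n"
| psi_sq_left: "\<lbrakk>k \<in> {1..n - 1}; i \<in> residue_seqs n;
      \<not> arrow n (entry i k) (entry i (k + 1)); arrow n (entry i (k + 1)) (entry i k)\<rbrakk>
    \<Longrightarrow> fpsi k * fpsi k * fe i - (fy k - fy (k + 1)) * fe i \<in> klr_rels n"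
| psi_sq_both: "\<lbrakk>k \<in> {1..n - 1}; i \<in> residue_seqs n;
      arrow n (entry i k) (entry i (k + 1)); arrow n (entry i (k + 1)) (entry i k)\<rbrakk>
    \<Longrightarrow> fpsi k * fpsi k * fe i
        - (fy (k + 1) - fy k) * (fy k - fy (k + 1)) * fe i \<in> klr_rels n"

text \<open>\<open>Idl\<close> is the two-sided ideal generated by a set, also when the ring is not commutative.\<close>

definition klr_ideal :: "'k::field itself \<Rightarrow> nat \<Rightarrow> 'k free_elem set" where
  "klr_ideal K n = Idl\<^bsub>klr_free K n\<^esub> (klr_rels n)"

definition klr :: "'k::field itself \<Rightarrow> nat \<Rightarrow> 'k free_elem set ring" where
  "klr K n = klr_free K n Quot klr_ideal K n"

definition klr_class :: "'k::field itself \<Rightarrow> nat \<Rightarrow> 'k free_elem \<Rightarrow> 'k free_elem set" where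
  "klr_class K n p = klr_ideal K n +>\<^bsub>klr_free K n\<^esub> p"

definition klr_e :: "'k::field itself \<Rightarrow> nat \<Rightarrow> nat list \<Rightarrow> 'k free_elem set" where
  "klr_e K n i = klr_class K n (fe i)"

definition klr_y :: "'k::field itself \<Rightarrow> nat \<Rightarrow> nat \<Rightarrow> 'k free_elem set" where
  "klr_y K n k = klr_class K n (fy k)"

definition cyc_ideal :: "'k::field itself \<Rightarrow> nat \<Rightarrow> 'k free_elem set set" where
  "cyc_ideal K n = Idl\<^bsub>klr K n\<^esub>
     ({klr_y K n 1 \<otimes>\<^bsub>klr K n\<^esub> klr_e K n i | i. i \<in> residue_seqs n \<and> entry i 1 = 0} \<union>
      {klr_e K n i | i. i \<in> residue_seqs n \<and> entry i 1 \<noteq> 0})"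

definition cyc_klr :: "'k::field itself \<Rightarrow> nat \<Rightarrow> 'k free_elem set set ring" where
  "cyc_klr K n = klr K n Quot cyc_ideal K n"

definition cyc_e :: "'k::field itself \<Rightarrow> nat \<Rightarrow> nat list \<Rightarrow> 'k free_elem set set" where
  "cyc_e K n i = cyc_ideal K n +>\<^bsub>klr K n\<^esub> klr_e K n i"

subsection \<open>Idempotents\<close>

definition idempotent_elem :: "('a, 'm) ring_scheme \<Rightarrow> 'a \<Rightarrow> bool" where
  "idempotent_elem R e \<longleftrightarrow> e \<in> carrier R \<and> e \<otimes>\<^bsub>R\<^esub> e = e"

definition orthogonal_elems :: "('a, 'm) ring_scheme \<Rightarrow> 'a \<Rightarrow> 'a \<Rightarrow> bool" where
  "orthogonal_elems R e f \<longleftrightarrow> e \<otimes>\<^bsub>R\<^esub> f = \<zero>\<^bsub>R\<^esub> \<and> f \<otimes>\<^bsub>R\<^esub> e = \<zero>\<^bsub>R\<^esub>"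

definition primitive_idempotent :: "('a, 'm) ring_scheme \<Rightarrow> 'a \<Rightarrow> bool" where
  "primitive_idempotent R e \<longleftrightarrow> idempotent_elem R e \<and> e \<noteq> \<zero>\<^bsub>R\<^esub> \<and>
     (\<forall>f g. idempotent_elem R f \<and> idempotent_elem R g \<and> orthogonal_elems R f g \<and>
        e = f \<oplus>\<^bsub>R\<^esub> g \<longrightarrow> f = \<zero>\<^bsub>R\<^esub> \<or> g = \<zero>\<^bsub>R\<^esub>)"

definition complete_primitive_orthogonal_idempotents :: "('a, 'm) ring_scheme \<Rightarrow> 'a set \<Rightarrow> bool"
  where "complete_primitive_orthogonal_idempotents R S \<longleftrightarrow>
     finite S \<and> (\<forall>e\<in>S. primitive_idempotent R e) \<and>
     pairwise (orthogonal_elems R) S \<and> (\<Oplus>\<^bsub>R\<^esub>e\<in>S. e) = \<one>\<^bsub>R\<^esub>"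

end

theory Submission
  imports Defs
begin

text \<open>Call a residue sequence growing if it starts with 0 and each later entry is adjacent in the
  quiver to an earlier one, so that every initial segment fills an arc of the cycle. Such an arc can
  be extended on either side until one vertex is missing, so there are \<open>2\<^sup>n\<^sup>-\<^sup>2\<close> growing sequences.

  If \<open>i\<close> is not growing, an entry without earlier neighbour can be moved to the front by
  \<open>\<psi>\<close>'s whose squares are 1, and the cyclotomic relation gives \<open>e(i) = 0\<close>. Conversely, the growing
  sequences index a basis of a representation on which all \<open>y\<^sub>k\<close> vanish and \<open>\<psi>\<^sub>k\<close> swaps
  nonadjacent entries; on it \<open>e(i)\<close> acts nontrivially for \<open>i\<close> growing.

  Primitivity: entries are distinct, so words in the \<open>\<psi>\<^sub>k\<close> can be straightened without error terms,
  and only the polynomials in the \<open>y\<^sub>k\<close> survive in \<open>e(i) R e(i)\<close>. As \<open>y\<^sub>k e(i) = 0\<close> for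
  \<open>k < n\<close> and \<open>y\<^sub>n\<^sup>2 e(i) = 0\<close>, this corner is spanned by \<open>e(i)\<close> and a square-zero
  element, hence is local.\<close>

subsection \<open>Residue sequences\<close>

text \<open>In a general KLR algebra, correction terms arise in moving y past \<psi> and in the
  braid relation, always at coinciding residues; here each residue occurs once, so there are none.
  No basis theorem is used: straightening only bounds the corner from above by two spanning
  elements. Whether y_n e(i) vanishes stays open, since every quotient of the dual numbers has only
  the trivial idempotents. Nonvanishing of e(i) comes from the module alone; the y's may act there
  as 0 because \<psi>_k^2 has to be 1 only at nonadjacent residues. The last position is special
  throughout. Before it, a new vertex touches only one end of the arc, so y_k e(i) can be traced
  back to y_1 e(i) = 0. The vertex that closes the cycle touches both ends (for n = 2, by the double
  arrow), so it can be chosen in one way only, and y_n is merely nilpotent.\<close>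

lemma length_residue_seq: "i \<in> residue_seqs n \<Longrightarrow> length i = n"
  by (simp add: length_finite_permutations_of_set)

lemma entry_inj:
  assumes "i \<in> residue_seqs n" "l \<in> {1..n}" "m \<in> {1..n}" "entry i l = entry i m"
  shows "l = m"
proof -
  have "distinct i" "length i = n"
    using assms length_residue_seq by (auto simp: permutations_of_set_def)
  then have "l - 1 = m - 1"
    using assms nth_eq_iff_index_eq[of i "l - 1" "m - 1"] by (auto simp: entry_def)
  then show ?thesis using assms by auto
qed

lemma entry_swap:
  assumes "i \<in> residue_seqs n" "k \<in> {1..n - 1}" "l \<in> {1..n}"
  shows "entry (swap_entries k i) l
    = (if l = k then entry i (k + 1) else if l = k + 1 then entry i k else entry i l)"
  using assms length_residue_seq[OF assms(1)]
  by (auto simp: swap_entries_def entry_def nth_list_update)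

lemma swap_in_residue_seqs:
  assumes "i \<in> residue_seqs n" "k \<in> {1..n - 1}"
  shows "swap_entries k i \<in> residue_seqs n"
proof -
  have "swap_entries k i = i[k - 1 := i ! k, k := i ! (k - 1)]"
    by (simp add: swap_entries_def entry_def)
  moreover have "k - 1 < length i" "k < length i"
    using assms length_residue_seq[OF assms(1)] by auto
  ultimately show ?thesis
    using assms by (auto simp: permutations_of_set_def)
qed

lemma residue_seq_eqI:
  assumes "i \<in> residue_seqs n" "j \<in> residue_seqs n" "\<And>l. l \<in> {1..n} \<Longrightarrow> entry i l = entry j l"
  shows "i = j"
proof (rule nth_equalityI)
  show "length i = length j" using assms length_residue_seq by metis
  fix l assume "l < length i"
  then show "i ! l = j ! l" 
    using assms(3)[of "Suc l"] length_residue_seq[OF assms(1)] by (auto simp: entry_def)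
qed

lemma swap_swap:
  assumes "i \<in> residue_seqs n" "k \<in> {1..n - 1}"
  shows "swap_entries k (swap_entries k i) = i"
  by (rule residue_seq_eqI[of _ n])
    (use assms in \<open>auto simp: entry_swap[of _ n] swap_in_residue_seqs\<close>)

lemma swap_commute:
  assumes "i \<in> residue_seqs n" "k \<in> {1..n - 1}" "l \<in> {1..n - 1}" "\<bar>int k - int l\<bar> > 1"
  shows "swap_entries k (swap_entries l i) = swap_entries l (swap_entries k i)"
proof (rule residue_seq_eqI[of _ n])
  have "k \<noteq> l" "k \<noteq> l + 1" "l \<noteq> k + 1" "k + 1 \<in> {1..n}" "l + 1 \<in> {1..n}"
    using assms(2-4) by auto
  then show "entry (swap_entries k (swap_entries l i)) m = entry (swap_entries l (swap_entries k i)) m"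
    if "m \<in> {1..n}" for m
    using assms(1-3) that by (simp add: entry_swap[of _ n] swap_in_residue_seqs)
qed (use assms in \<open>simp_all add: swap_in_residue_seqs\<close>)

lemma swap_braid:
  assumes "i \<in> residue_seqs n" "k \<in> {1..n - 1}" "k + 1 \<in> {1..n - 1}"
  shows "swap_entries k (swap_entries (k + 1) (swap_entries k i))
    = swap_entries (k + 1) (swap_entries k (swap_entries (k + 1) i))"
proof (rule residue_seq_eqI[of _ n])
  show "entry (swap_entries k (swap_entries (k + 1) (swap_entries k i))) m
    = entry (swap_entries (k + 1) (swap_entries k (swap_entries (k + 1) i))) m"
    if "m \<in> {1..n}" for m
    using assms that by (simp add: entry_swap[of _ n] swap_in_residue_seqs)
qed (use assms in \<open>simp_all add: swap_in_residue_seqs\<close>)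

section \<open>Growing sequences and arcs of the cycle\<close>

text \<open>Orientation affects only the sign in the quadratic relation; vanishing of idempotents
  and the module depend only on whether two residues are joined.\<close>

definition adj :: "nat \<Rightarrow> nat \<Rightarrow> nat \<Rightarrow> bool" where
  "adj n i j \<longleftrightarrow> arrow n i j \<or> arrow n j i"

text \<open>Stated for lists of any length, with positions from 0, so that prefixes can be built up
  by appending; \<open>growing_iff_entry\<close> passes to positions from 1.\<close>

definition growing :: "nat \<Rightarrow> nat list \<Rightarrow> bool" where
  "growing n xs \<longleftrightarrow> xs ! 0 = 0 \<and> (\<forall>k\<in>{1..<length xs}. \<exists>m<k. adj n (xs ! m) (xs ! k))"

lemma adj_sym: "adj n i j \<longleftrightarrow> adj n j i"
  by (auto simp: adj_def)

lemma adj_iff: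
  assumes "n > 1" "i < n" "j < n"
  shows "adj n i j \<longleftrightarrow> j = i + 1 \<or> i = j + 1 \<or> (i = n - 1 \<and> j = 0) \<or> (j = n - 1 \<and> i = 0)"
  using assms by (auto simp: adj_def arrow_def)

lemma growing_snoc:
  assumes "xs \<noteq> []"
  shows "growing n (xs @ [x]) \<longleftrightarrow> growing n xs \<and> (\<exists>y\<in>set xs. adj n y x)"
proof -
  have "(\<exists>y\<in>set xs. adj n y x) \<longleftrightarrow> (\<exists>m<length xs. adj n (xs ! m) x)"
    by (metis in_set_conv_nth)
  moreover have "{1..<length (xs @ [x])} = insert (length xs) {1..<length xs}"
    using assms by (auto simp: Suc_le_eq)
  ultimately show ?thesis
    using assms unfolding growing_def
    by (auto simp: nth_append simp del: One_nat_def cong: conj_cong)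
qed

lemma growing_take:
  assumes "growing n xs" "k > 0"
  shows "growing n (take k xs)"
  unfolding growing_def
proof (intro conjI ballI)
  show "take k xs ! 0 = 0" using assms by (simp add: growing_def)
  fix l assume l: "l \<in> {1..<length (take k xs)}"
  then have "l \<in> {1..<length xs}" by simp
  then obtain m where "m < l" "adj n (xs ! m) (xs ! l)"
    using assms unfolding growing_def by blast
  with l show "\<exists>m<l. adj n (take k xs ! m) (take k xs ! l)"
    by (intro exI[of _ m]) simp
qed

text \<open>The arc runs from 0 up to \<open>a\<close> and, across the arrow from
  \<open>n - 1\<close> to 0, down to \<open>n - b\<close>. Only its two ends have neighbours
  outside. For \<open>b = 0\<close> the lower end is 0 itself, hence the case distinction.\<close>

lemma arc_neighbour:
  assumes "n > 1" "y \<in> {..a} \<union> {n - b..<n}" "x < n" "x \<notin> {..a} \<union> {n - b..<n}" "adj n y x"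
  shows "x = a + 1 \<and> y = a \<or> x = n - b - 1 \<and> y = (if b = 0 then 0 else n - b)"
proof -
  have x: "a < x" "x < n - b" and y: "y < n" "y \<le> a \<or> n - b \<le> y"
    using assms(2-4) by auto
  consider "x = y + 1" | "y = x + 1" | "y = n - 1" "x = 0" | "x = n - 1" "y = 0"
    using assms(5) unfolding adj_iff[OF assms(1) y(1) assms(3)] by blast
  then show ?thesis
  proof cases
    case 1 with x y show ?thesis by linarith
  next
    case 2 with x y show ?thesis by (cases "b = 0") auto
  next
    case 3 with x show ?thesis by simp
  next
    case 4
    with x have "b = 0" by linarith
    with 4 show ?thesis by simp
  qed
qed

lemma growing_arc:
  assumes "n > 1" "distinct xs" "set xs \<subseteq> {0..<n}" "xs \<noteq> []" "growing n xs"
  shows "\<exists>a b. a + b + 1 = length xs \<and> set xs = {..a} \<union> {n - b..<n}"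
  using assms(2-)
proof (induction xs rule: rev_induct)
  case (snoc x xs)
  show ?case
  proof (cases "xs = []")
    case True
    with snoc have "x = 0" by (simp add: growing_def)
    with True show ?thesis by (intro exI[of _ 0]) auto
  next
    case False
    with snoc obtain a b where ab: "a + b + 1 = length xs" "set xs = {..a} \<union> {n - b..<n}"
      by (auto simp: growing_snoc)
    from snoc False obtain y where y: "y \<in> set xs" "adj n y x" by (auto simp: growing_snoc)
    have x: "x < n" "x \<notin> set xs" using snoc y by auto
    have xa: "a < x" "x < n - b" using x ab by auto
    have "x = a + 1 \<or> x = n - b - 1"
      using arc_neighbour[OF assms(1) _ x(1) _ y(2)] y(1) x(2) unfolding ab(2) by blast
    then show ?thesis
    proof
      assume "x = a + 1"
      then have "set (xs @ [x]) = {..a + 1} \<union> {n - b..<n}"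
        unfolding set_append ab(2) by (simp add: atMost_Suc)
      then show ?thesis using ab(1) by (intro exI[of _ "a + 1"] exI[of _ b]) simp
    next
      assume "x = n - b - 1"
      moreover have "{n - (b + 1)..<n} = insert (n - b - 1) {n - b..<n}"
        using xa by (auto simp del: One_nat_def)
      ultimately have "set (xs @ [x]) = {..a} \<union> {n - (b + 1)..<n}"
        unfolding set_append ab(2) by simp
      then show ?thesis using ab(1) by (intro exI[of _ a] exI[of _ "b + 1"]) simp
    qed
  qed
qed simp

text \<open>The ends of the arc lead to the outside vertices \<open>a + 1\<close> and
  \<open>n - b - 1\<close>. With at least two vertices missing these differ, so an outside vertex
  determines the end that it touches.\<close>

lemma growing_unique_neighbour:
  assumes "n > 1" "distinct xs" "set xs \<subseteq> {0..<n}" "xs \<noteq> []" "growing n xs"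
    and "length xs + 1 < n" "x < n" "x \<notin> set xs"
    and "y \<in> set xs" "z \<in> set xs" "adj n y x" "adj n z x"
  shows "y = z"
proof -
  obtain a b where ab: "a + b + 1 = length xs" "set xs = {..a} \<union> {n - b..<n}"
    using growing_arc[OF assms(1-5)] by blast
  have "x = a + 1 \<and> y = a \<or> x = n - b - 1 \<and> y = (if b = 0 then 0 else n - b)"
    "x = a + 1 \<and> z = a \<or> x = n - b - 1 \<and> z = (if b = 0 then 0 else n - b)"
    using arc_neighbour[OF assms(1) _ assms(7)] assms(8-12) unfolding ab(2) by blast+
  moreover have "a + 1 \<noteq> n - b - 1" using ab(1) assms(6) by linarith
  ultimately show ?thesis by auto
qed

section \<open>Counting growing sequences\<close>

definition growing_lists :: "nat \<Rightarrow> nat \<Rightarrow> nat list set" where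
  "growing_lists n k = {xs. length xs = k \<and> distinct xs \<and> set xs \<subseteq> {0..<n} \<and> growing n xs}"

lemma finite_growing_lists: "finite (growing_lists n k)"
  by (rule finite_subset[OF _ finite_lists_length_eq[of "{0..<n}" k]])
    (auto simp: growing_lists_def)

text \<open>The possible next vertices are \<open>a + 1\<close> and \<open>n - b - 1\<close>; they
  coincide exactly when a single vertex is missing.\<close>

lemma card_extensions:
  assumes "n > 1" "xs \<in> growing_lists n k" "0 < k" "k < n"
  shows "card {x. x < n \<and> x \<notin> set xs \<and> (\<exists>y\<in>set xs. adj n y x)} = (if k + 1 = n then 1 else 2)"
proof -
  have xs: "distinct xs" "set xs \<subseteq> {0..<n}" "xs \<noteq> []" "growing n xs" and len: "length xs = k"
    using assms by (auto simp: growing_lists_def)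
  obtain a b where ab: "a + b + 1 = k" "set xs = {..a} \<union> {n - b..<n}"
    using growing_arc[OF assms(1) xs] len by blast
  have "{x. x < n \<and> x \<notin> set xs \<and> (\<exists>y\<in>set xs. adj n y x)} = {a + 1, n - b - 1}" (is "?L = ?R")
  proof
    show "?L \<subseteq> ?R"
    proof
      fix x assume "x \<in> ?L"
      then obtain y where x: "x < n" "x \<notin> set xs" and y: "y \<in> set xs" "adj n y x" by blast
      show "x \<in> ?R"
        using arc_neighbour[OF assms(1) _ x(1) _ y(2)] y(1) x(2) unfolding ab(2) by blast
    qed
    have "adj n a (a + 1)" using ab assms by (subst adj_iff) auto
    moreover have "a \<in> set xs" "a + 1 \<notin> set xs" "n - b - 1 \<notin> set xs" using ab assms by auto
    moreover have "adj n (if b = 0 then 0 else n - b) (n - b - 1)"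
      using ab assms by (subst adj_iff) auto
    moreover have "(if b = 0 then 0 else n - b) \<in> set xs" using ab assms by auto
    moreover have "a + 1 < n" "n - b - 1 < n" using ab assms by auto
    ultimately show "?R \<subseteq> ?L" by blast
  qed
  moreover have "(a + 1 = n - b - 1) = (k + 1 = n)" using ab assms by auto
  ultimately show ?thesis by (simp add: card_insert_if)
qed

lemma card_growing_lists_Suc:
  assumes "n > 1" "0 < k" "k < n"
  shows "card (growing_lists n (Suc k))
    = (if k + 1 = n then 1 else 2) * card (growing_lists n k)"
proof -
  let ?Ext = "\<lambda>xs. {x. x < n \<and> x \<notin> set xs \<and> (\<exists>y\<in>set xs. adj n y x)}"
  have "growing_lists n (Suc k) = (\<lambda>(xs, x). xs @ [x]) ` Sigma (growing_lists n k) ?Ext"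
  proof (intro Set.set_eqI iffI)
    fix ys assume ys: "ys \<in> growing_lists n (Suc k)"
    then obtain xs x where "ys = xs @ [x]" "length xs = k"
      by (auto simp: growing_lists_def length_Suc_conv_rev)
    moreover from this have "xs \<noteq> []" using assms by auto
    ultimately show "ys \<in> (\<lambda>(xs, x). xs @ [x]) ` Sigma (growing_lists n k) ?Ext"
      using ys by (force simp: growing_lists_def growing_snoc)
  next
    fix ys assume "ys \<in> (\<lambda>(xs, x). xs @ [x]) ` Sigma (growing_lists n k) ?Ext"
    then obtain xs x where "ys = xs @ [x]" "xs \<in> growing_lists n k" "x \<in> ?Ext xs" by auto
    moreover from this have "xs \<noteq> []" using assms by (auto simp: growing_lists_def)
    ultimately show "ys \<in> growing_lists n (Suc k)"
      by (auto simp: growing_lists_def growing_snoc)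
  qed
  moreover have "inj_on (\<lambda>(xs, x). xs @ [x]) (Sigma (growing_lists n k) ?Ext)"
    by (auto simp: inj_on_def)
  ultimately have "card (growing_lists n (Suc k)) = card (Sigma (growing_lists n k) ?Ext)"
    by (simp add: card_image)
  also have "\<dots> = (\<Sum>xs\<in>growing_lists n k. card (?Ext xs))"
    by (rule card_SigmaI) (auto simp: finite_growing_lists)
  also have "\<dots> = (\<Sum>xs\<in>growing_lists n k. if k + 1 = n then 1 else 2)"
    by (rule sum.cong) (use card_extensions assms in auto)
  finally show ?thesis by simp
qed

lemma card_growing_lists:
  assumes "n > 1" "Suc k < n"
  shows "card (growing_lists n (Suc k)) = 2 ^ k"
  using assms(2)
proof (induction k)
  case 0
  have "growing_lists n 1 = {[0]}"
    using assms by (auto simp: growing_lists_def growing_def length_Suc_conv)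
  then show ?case by simp
next
  case (Suc k)
  then show ?case using card_growing_lists_Suc[OF assms(1), of "Suc k"] by simp
qed

lemma card_growing_residue_seqs:
  assumes "n > 1"
  shows "card {i \<in> residue_seqs n. growing n i} = 2 ^ (n - 2)"
proof -
  have "{i \<in> residue_seqs n. growing n i} = growing_lists n n"
  proof (intro Set.set_eqI iffI)
    fix i assume "i \<in> growing_lists n n"
    then have "distinct i" "set i \<subseteq> {0..<n}" "growing n i" "length i = n"
      by (auto simp: growing_lists_def)
    moreover from this have "set i = {0..<n}"
      by (intro card_subset_eq) (auto simp: distinct_card)
    ultimately show "i \<in> {i \<in> residue_seqs n. growing n i}"
      by (auto simp: permutations_of_set_def)
  qed (auto simp: growing_lists_def permutations_of_set_def length_finite_permutations_of_set
      dest: distinct_card)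
  \<comment> \<open>Of the n - 1 extensions of the list [0], the last is forced and each other one
    doubles the count, whence the exponent n - 2.\<close>
  moreover obtain k where k: "n = Suc (Suc k)" using assms less_eqE[of 2 n] by auto
  ultimately show ?thesis
    using card_growing_lists_Suc[OF assms, of "Suc k"] card_growing_lists[OF assms, of k] by simp
qed

section \<open>Growth under swaps of nonadjacent entries\<close>

lemma growing_iff_entry:
  assumes "i \<in> residue_seqs n"
  shows "growing n i \<longleftrightarrow> entry i 1 = 0 \<and> (\<forall>k\<in>{2..n}. \<exists>m\<in>{1..<k}. adj n (entry i m) (entry i k))"
proof -
  have "(\<forall>k\<in>{1..<n}. \<exists>m<k. adj n (i ! m) (i ! k))
    \<longleftrightarrow> (\<forall>k\<in>{2..n}. \<exists>m\<in>{1..<k}. adj n (i ! (m - 1)) (i ! (k - 1)))" (is "?L \<longleftrightarrow> ?R")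
  proof
    assume L: ?L
    show ?R
    proof
      fix k assume k: "k \<in> {2..n}"
      then have "k - 1 \<in> {1..<n}" by auto
      with L obtain m where "m < k - 1" "adj n (i ! m) (i ! (k - 1))" by blast
      then show "\<exists>m\<in>{1..<k}. adj n (i ! (m - 1)) (i ! (k - 1))"
        by (intro bexI[of _ "m + 1"]) auto
    qed
  next
    assume R: ?R
    show ?L
    proof
      fix k assume k: "k \<in> {1..<n}"
      then have "k + 1 \<in> {2..n}" by auto
      with R obtain m where "m \<in> {1..<k + 1}" "adj n (i ! (m - 1)) (i ! (k + 1 - 1))" by blast
      then show "\<exists>m<k. adj n (i ! m) (i ! k)"
        by (intro exI[of _ "m - 1"]) auto
    qed
  qed
  then show ?thesis using length_residue_seq[OF assms] by (simp add: growing_def entry_def)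
qed

text \<open>Earlier neighbours travel along with the swap. Order changes only between positions k
  and k + 1, and these do not support each other. This makes the span of the growing sequences
  stable under \<psi>_k.\<close>

lemma growing_swap:
  assumes "i \<in> residue_seqs n" "growing n i" "k \<in> {1..n - 1}"
    "\<not> adj n (entry i k) (entry i (k + 1))"
  shows "growing n (swap_entries k i)"
proof -
  have g: "entry i 1 = 0" "\<And>l. l \<in> {2..n} \<Longrightarrow> \<exists>m\<in>{1..<l}. adj n (entry i m) (entry i l)"
    using assms(2) growing_iff_entry[OF assms(1)] by auto
  \<comment> \<open>The second entry can be supported only by the first, so a nonadjacent swap never
    displaces the leading 0.\<close>
  have k1: "k \<noteq> 1"
  proof
    assume "k = 1"
    with g(2)[of 2] assms(3,4) show False
      by (auto simp: numeral_2_eq_2)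
  qed
  note sw = entry_swap[OF assms(1,3)]
  show ?thesis
    unfolding growing_iff_entry[OF swap_in_residue_seqs[OF assms(1,3)]]
  proof (intro conjI ballI)
    show "entry (swap_entries k i) 1 = 0" using g(1) k1 assms(3) by (subst sw) auto
    fix l assume l: "l \<in> {2..n}"
    \<comment> \<open>\<open>l'\<close> is the old position of the entry now at \<open>l\<close>;
      the witness found at \<open>m\<close> is now at \<open>m'\<close>.\<close>
    define l' where "l' = (if l = k then k + 1 else if l = k + 1 then k else l)"
    have l': "l' \<in> {2..n}" using l assms(3) k1 by (auto simp: l'_def)
    obtain m where m: "m \<in> {1..<l'}" "adj n (entry i m) (entry i l')" using g(2)[OF l'] by blast
    define m' where "m' = (if m = k then k + 1 else if m = k + 1 then k else m)"
    have nk: "\<not> (l = k \<and> m = k)" using m assms(4) by (auto simp: l'_def)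
    have "m' \<in> {1..<l}" using m nk assms(3) by (auto simp: m'_def l'_def split: if_splits)
    moreover have "entry (swap_entries k i) m' = entry i m"
      using m l' l assms(3) by (subst sw) (auto simp: m'_def)
    moreover have "entry (swap_entries k i) l = entry i l'"
      using l by (subst sw) (auto simp: l'_def)
    ultimately show "\<exists>m\<in>{1..<l}. adj n (entry (swap_entries k i) m) (entry (swap_entries k i) l)"
      using m(2) by metis
  qed
qed

subsection \<open>Relations in the cyclotomic quotient\<close>

lemma (in ring) minus_eq_zero_imp_eq:
  assumes "x \<in> carrier R" "z \<in> carrier R" "x \<ominus> z = \<zero>"
  shows "x = z"
  using assms minus_equality[of x "\<ominus> z"] by (simp add: minus_eq)

text \<open>Separates consequences of the relations from computations with cosets. \<open>C\<close>
  carries the scalars. \<open>generation\<close> is the induction principle of a generated algebra;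
  left multiplication suffices, as words can be built from their right end. Nothing here forces
  \<open>E i\<close> to be nonzero.\<close>

locale cyclotomic_klr = ring R for R (structure) +
  fixes n :: nat and E :: "nat list \<Rightarrow> 'a" and Y P :: "nat \<Rightarrow> 'a" and C :: "'k::field \<Rightarrow> 'a"
  assumes n_gt_1: "n > 1"
    and E_closed [simp]: "i \<in> residue_seqs n \<Longrightarrow> E i \<in> carrier R"
    and Y_closed [simp]: "k \<in> {1..n} \<Longrightarrow> Y k \<in> carrier R"
    and P_closed [simp]: "k \<in> {1..n - 1} \<Longrightarrow> P k \<in> carrier R"
    and C_closed [simp]: "C c \<in> carrier R"
    and C_add: "C (c + d) = C c \<oplus> C d"
    and C_mult: "C (c * d) = C c \<otimes> C d"
    and C_one: "C 1 = \<one>"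
    and C_E: "i \<in> residue_seqs n \<Longrightarrow> C c \<otimes> E i = E i \<otimes> C c"
    and C_Y: "k \<in> {1..n} \<Longrightarrow> C c \<otimes> Y k = Y k \<otimes> C c"
    and C_P: "k \<in> {1..n - 1} \<Longrightarrow> C c \<otimes> P k = P k \<otimes> C c"
    and generation: "\<lbrakk>S \<subseteq> carrier R; \<one> \<in> S; \<And>x z. \<lbrakk>x \<in> S; z \<in> S\<rbrakk> \<Longrightarrow> x \<oplus> z \<in> S;
      \<And>c x. x \<in> S \<Longrightarrow> C c \<otimes> x \<in> S;
      \<And>i x. \<lbrakk>i \<in> residue_seqs n; x \<in> S\<rbrakk> \<Longrightarrow> E i \<otimes> x \<in> S;
      \<And>k x. \<lbrakk>k \<in> {1..n}; x \<in> S\<rbrakk> \<Longrightarrow> Y k \<otimes> x \<in> S;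
      \<And>k x. \<lbrakk>k \<in> {1..n - 1}; x \<in> S\<rbrakk> \<Longrightarrow> P k \<otimes> x \<in> S\<rbrakk> \<Longrightarrow> carrier R \<subseteq> S"
    and E_E: "\<lbrakk>i \<in> residue_seqs n; j \<in> residue_seqs n\<rbrakk>
      \<Longrightarrow> E i \<otimes> E j = (if i = j then E i else \<zero>)"
    and E_sum: "(\<Oplus>i\<in>residue_seqs n. E i) = \<one>"
    and Y_E: "\<lbrakk>k \<in> {1..n}; i \<in> residue_seqs n\<rbrakk> \<Longrightarrow> Y k \<otimes> E i = E i \<otimes> Y k"
    and P_E: "\<lbrakk>k \<in> {1..n - 1}; i \<in> residue_seqs n\<rbrakk>
      \<Longrightarrow> P k \<otimes> E i = E (swap_entries k i) \<otimes> P k"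
    and Y_Y: "\<lbrakk>k \<in> {1..n}; l \<in> {1..n}\<rbrakk> \<Longrightarrow> Y k \<otimes> Y l = Y l \<otimes> Y k"
    and P_Y: "\<lbrakk>k \<in> {1..n - 1}; l \<in> {1..n}; l \<noteq> k; l \<noteq> k + 1\<rbrakk>
      \<Longrightarrow> P k \<otimes> Y l = Y l \<otimes> P k"
    and P_P: "\<lbrakk>k \<in> {1..n - 1}; l \<in> {1..n - 1}; \<bar>int k - int l\<bar> > 1\<rbrakk>
      \<Longrightarrow> P k \<otimes> P l = P l \<otimes> P k"
    and P_Y_right: "\<lbrakk>k \<in> {1..n - 1}; i \<in> residue_seqs n\<rbrakk>
      \<Longrightarrow> P k \<otimes> Y (k + 1) \<otimes> E i = Y k \<otimes> P k \<otimes> E i"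
    and Y_P_right: "\<lbrakk>k \<in> {1..n - 1}; i \<in> residue_seqs n\<rbrakk>
      \<Longrightarrow> Y (k + 1) \<otimes> P k \<otimes> E i = P k \<otimes> Y k \<otimes> E i"
    and braid: "\<lbrakk>k \<in> {1..n - 1}; k + 1 \<in> {1..n - 1}; i \<in> residue_seqs n\<rbrakk>
      \<Longrightarrow> P k \<otimes> P (k + 1) \<otimes> P k \<otimes> E i = P (k + 1) \<otimes> P k \<otimes> P (k + 1) \<otimes> E i"
    and P_sq_none: "\<lbrakk>k \<in> {1..n - 1}; i \<in> residue_seqs n;
      \<not> arrow n (entry i k) (entry i (k + 1)); \<not> arrow n (entry i (k + 1)) (entry i k)\<rbrakk>
      \<Longrightarrow> P k \<otimes> P k \<otimes> E i = E i"
    and P_sq_right: "\<lbrakk>k \<in> {1..n - 1}; i \<in> residue_seqs n;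
      arrow n (entry i k) (entry i (k + 1)); \<not> arrow n (entry i (k + 1)) (entry i k)\<rbrakk>
      \<Longrightarrow> P k \<otimes> P k \<otimes> E i = (Y (k + 1) \<ominus> Y k) \<otimes> E i"
    and P_sq_left: "\<lbrakk>k \<in> {1..n - 1}; i \<in> residue_seqs n;
      \<not> arrow n (entry i k) (entry i (k + 1)); arrow n (entry i (k + 1)) (entry i k)\<rbrakk>
      \<Longrightarrow> P k \<otimes> P k \<otimes> E i = (Y k \<ominus> Y (k + 1)) \<otimes> E i"
    and P_sq_both: "\<lbrakk>k \<in> {1..n - 1}; i \<in> residue_seqs n;
      arrow n (entry i k) (entry i (k + 1)); arrow n (entry i (k + 1)) (entry i k)\<rbrakk>
      \<Longrightarrow> P k \<otimes> P k \<otimes> E i = (Y (k + 1) \<ominus> Y k) \<otimes> (Y k \<ominus> Y (k + 1)) \<otimes> E i"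
    and cyc_Y: "\<lbrakk>i \<in> residue_seqs n; entry i 1 = 0\<rbrakk> \<Longrightarrow> Y 1 \<otimes> E i = \<zero>"
    and cyc_E: "\<lbrakk>i \<in> residue_seqs n; entry i 1 \<noteq> 0\<rbrakk> \<Longrightarrow> E i = \<zero>"
begin

lemma P_closed': "0 < k \<Longrightarrow> k < n \<Longrightarrow> P k \<in> carrier R"
  by simp

lemma swap_closed [simp]:
  "\<lbrakk>i \<in> residue_seqs n; k \<in> {1..n - 1}\<rbrakk> \<Longrightarrow> swap_entries k i \<in> residue_seqs n"
  by (rule swap_in_residue_seqs)

lemma E_P:
  assumes "k \<in> {1..n - 1}" "i \<in> residue_seqs n"
  shows "E i \<otimes> P k = P k \<otimes> E (swap_entries k i)"
  using P_E[OF assms(1) swap_closed[OF assms(2,1)]] swap_swap[OF assms(2,1)] by simp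

text \<open>The idempotents sum to 1. This strips the trailing e(i) from relations that have the
  same form for all i.\<close>

lemma eq_if_eq_on_E:
  assumes "x \<in> carrier R" "z \<in> carrier R"
    and "\<And>i. i \<in> residue_seqs n \<Longrightarrow> x \<otimes> E i = z \<otimes> E i"
  shows "x = z"
proof -
  have "x = (\<Oplus>i\<in>residue_seqs n. x \<otimes> E i)"
    using assms(1) E_sum finsum_rdistr[of "residue_seqs n" x E] by auto
  also have "\<dots> = (\<Oplus>i\<in>residue_seqs n. z \<otimes> E i)"
    by (rule finsum_cong') (use assms in auto)
  also have "\<dots> = z"
    using assms(2) E_sum finsum_rdistr[of "residue_seqs n" z E] by auto
  finally show ?thesis .
qed

lemma P_Suc_Y:
  assumes "k \<in> {1..n - 1}"
  shows "Y k \<otimes> P k = P k \<otimes> Y (k + 1)"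
  by (rule eq_if_eq_on_E) (use assms P_Y_right[OF assms] in \<open>auto simp del: One_nat_def\<close>)

lemma Suc_Y_P:
  assumes "k \<in> {1..n - 1}"
  shows "Y (k + 1) \<otimes> P k = P k \<otimes> Y k"
  by (rule eq_if_eq_on_E) (use assms Y_P_right[OF assms] in auto)

lemma P_braid:
  assumes "k \<in> {1..n - 1}" "k + 1 \<in> {1..n - 1}"
  shows "P (k + 1) \<otimes> (P k \<otimes> P (k + 1)) = P k \<otimes> (P (k + 1) \<otimes> P k)"
  by (rule eq_if_eq_on_E) (use assms braid[OF assms] in \<open>auto simp: m_assoc\<close>)

text \<open>Here \<psi>_k^2 acts as 1, so vanishing of e(s_k i) passes to e(i), and statements about
  y's can be transported.\<close>

lemma E_eq_P_E_P:
  assumes "k \<in> {1..n - 1}" "i \<in> residue_seqs n" "\<not> adj n (entry i k) (entry i (k + 1))"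
  shows "E i = P k \<otimes> E (swap_entries k i) \<otimes> P k"
proof -
  have "E i = P k \<otimes> P k \<otimes> E i" using P_sq_none[OF assms(1,2)] assms(3) by (simp add: adj_def)
  also have "\<dots> = P k \<otimes> (P k \<otimes> E i)" using assms by (simp add: m_assoc)
  also have "\<dots> = P k \<otimes> (E (swap_entries k i) \<otimes> P k)" using assms by (simp only: P_E)
  finally show ?thesis using assms by (simp add: m_assoc)
qed

text \<open>For adjacent entries this turns the vanishing of a neighbouring idempotent into a
  relation among the y's on e(i).\<close>

lemma P_sq_E_eq_zero:
  assumes "k \<in> {1..n - 1}" "i \<in> residue_seqs n" "E (swap_entries k i) = \<zero>"
  shows "P k \<otimes> P k \<otimes> E i = \<zero>"
proof -
  have "P k \<otimes> P k \<otimes> E i = P k \<otimes> (P k \<otimes> E i)" using assms by (simp add: m_assoc)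
  also have "\<dots> = P k \<otimes> (E (swap_entries k i) \<otimes> P k)" using assms by (simp only: P_E)
  finally show ?thesis using assms by simp
qed

section \<open>Vanishing idempotents and nilpotent y's\<close>

text \<open>The entry at k + 1 moves left past entries to which it is not joined. In the end it
  would have to share position 1 with another residue, and only one of them can be 0.\<close>

lemma E_eq_zero_if_isolated:
  assumes "i \<in> residue_seqs n" "0 < k" "k < n" "\<And>m. m \<in> {1..k} \<Longrightarrow> \<not> adj n (entry i m) (entry i (k + 1))"
  shows "E i = \<zero>"
  using assms
proof (induction k arbitrary: i)
  case (Suc k)
  let ?s = "swap_entries (Suc k) i"
  have k: "Suc k \<in> {1..n - 1}" using Suc.prems by simp
  note sw = entry_swap[OF Suc.prems(1) k]
  \<comment> \<open>Either alternative suffices, as e(i) factors through e(s i). At the front,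
    whichever of the two sequences does not start with 0 is killed by the cyclotomic
    relation.\<close>
  have "E ?s = \<zero> \<or> E i = \<zero>"
  proof (cases "k = 0")
    case True
    have "entry i 1 \<noteq> entry i 2" using entry_inj[OF Suc.prems(1), of 1 2] n_gt_1 by auto
    moreover have "entry ?s 1 = entry i 2" using True n_gt_1 by (subst sw) (auto simp: numeral_2_eq_2)
    ultimately show ?thesis
      using cyc_E[OF Suc.prems(1)] cyc_E[OF swap_closed[OF Suc.prems(1) k]] by metis
  next
    case False
    have "E ?s = \<zero>"
    proof (rule Suc.IH)
      show "?s \<in> residue_seqs n" "0 < k" "k < n" using Suc.prems k False by auto
      fix m assume m: "m \<in> {1..k}"
      then have "entry ?s m = entry i m" using Suc.prems by (subst sw) auto
      moreover have "entry ?s (k + 1) = entry i (Suc k + 1)" using Suc.prems by (subst sw) auto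
      ultimately show "\<not> adj n (entry ?s m) (entry ?s (k + 1))"
        using Suc.prems(4)[of m] m by simp
    qed
    then show ?thesis ..
  qed
  moreover have "E i = P (Suc k) \<otimes> E ?s \<otimes> P (Suc k)"
    using Suc.prems(4)[of "Suc k"] by (intro E_eq_P_E_P[OF k Suc.prems(1)]) simp
  ultimately show ?case using k by auto
qed simp

lemma E_eq_zero_if_not_growing:
  assumes "i \<in> residue_seqs n" "\<not> growing n i"
  shows "E i = \<zero>"
proof (cases "entry i 1 = 0")
  case True
  then obtain k where "k \<in> {2..n}" "\<forall>m\<in>{1..<k}. \<not> adj n (entry i m) (entry i k)"
    using assms growing_iff_entry by blast
  then show ?thesis
    using E_eq_zero_if_isolated[OF assms(1), of "k - 1"] by force
next
  case False
  then show ?thesis using cyc_E assms by blast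
qed

lemma arrow_both_imp:
  assumes "arrow n a b" "arrow n b a"
  shows "n = 2"
  using assms n_gt_1 by (auto simp: arrow_def)

text \<open>Conjugating by \<open>\<psi>\<^sub>k\<close> reduces the index of \<open>y\<close>, unless \<open>i\<^sub>k\<close> and \<open>i\<^sub>k\<^sub>+\<^sub>1\<close> are
  adjacent. In that case the neighbour is unique, \<open>s\<^sub>k \<cdot> i\<close> is not growing, and the quadratic
  relation identifies \<open>y\<^sub>k\<^sub>+\<^sub>1 e(i)\<close> with \<open>y\<^sub>k e(i)\<close>.\<close>

lemma Y_E_eq_zero:
  assumes "i \<in> residue_seqs n" "0 < k" "k < n"
  shows "Y k \<otimes> E i = \<zero>"
  using assms
proof (induction k arbitrary: i)
  case (Suc k)
  show ?case
  proof (cases "growing n i")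
    case False
    then show ?thesis using E_eq_zero_if_not_growing Suc.prems by simp
  next
    case gr: True
    show ?thesis
    proof (cases "k = 0")
      case True
      then show ?thesis using cyc_Y Suc.prems gr growing_iff_entry by auto
    next
      case False
      let ?s = "swap_entries k i"
      have k: "k \<in> {1..n - 1}" "k \<in> {1..n}" "Suc k \<in> {1..n}" using Suc.prems False by auto
      note sw = entry_swap[OF Suc.prems(1) k(1)]
      show ?thesis
      proof (cases "adj n (entry i k) (entry i (k + 1))")
        case False
        have "Y (k + 1) \<otimes> E i = Y (k + 1) \<otimes> P k \<otimes> E ?s \<otimes> P k"
          using E_eq_P_E_P[OF k(1) Suc.prems(1) False] Suc.prems k by (simp add: m_assoc)
        also have "\<dots> = P k \<otimes> (Y k \<otimes> E ?s) \<otimes> P k"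
          using k Suc.prems by (subst Suc_Y_P) (auto simp: m_assoc)
        also have "\<dots> = \<zero>"
          using Suc.IH[of ?s] k Suc.prems by simp
        finally show ?thesis by simp
      next
        case True
        have "E ?s = \<zero>"
        \<comment> \<open>For k = 1 the swap spoils the leading 0; for larger k it leaves the moved
          entry without an earlier neighbour.\<close>
        proof (cases "k = 1")
          case True
          have "entry i 1 = 0" using gr growing_iff_entry Suc.prems by blast
          moreover have "entry i 1 \<noteq> entry i 2"
            using entry_inj[OF Suc.prems(1), of 1 2] n_gt_1 by auto
          moreover have "entry ?s 1 = entry i 2"
            using True n_gt_1 by (subst sw) (auto simp: numeral_2_eq_2)
          ultimately show ?thesis
            using cyc_E[OF swap_closed[OF Suc.prems(1) k(1)]] by metis
        next
          case False
          have i: "distinct i" "set i = {0..<n}" "length i = n"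
            using Suc.prems(1) length_residue_seq by (auto simp: permutations_of_set_def)
          have "\<not> adj n (entry i m) (entry i (k + 1))" if m: "m \<in> {1..k - 1}" for m
          proof
            assume am: "adj n (entry i m) (entry i (k + 1))"
            have nth: "entry i l \<in> set (take k i)" if "l \<in> {1..k}" for l
              using that i Suc.prems k by (auto simp: entry_def in_set_conv_nth intro!: exI[of _ "l - 1"])
            have "i ! k \<notin> set (take k i)"
              using i Suc.prems by (auto simp: in_set_conv_nth nth_eq_iff_index_eq)
            moreover have "i ! k < n" using i Suc.prems nth_mem[of k i] by auto
            moreover have "set (take k i) \<subseteq> {0..<n}" using i set_take_subset[of k i] by blast
            moreover have "distinct (take k i)" using i by simp
            moreover have "entry i m \<in> set (take k i)" "entry i k \<in> set (take k i)"
              using m k by (auto intro!: nth)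
            \<comment> \<open>The bound k + 1 < n enters here: a vertex closing the cycle could
              touch both ends of the arc, so this argument stops short of
              \<open>Y n\<close>.\<close>
            moreover have "take k i \<noteq> []" "length (take k i) + 1 < n" using i Suc.prems k by auto
            ultimately have "entry i m = entry i k"
              using growing_unique_neighbour[OF n_gt_1, of "take k i" "i ! k" "entry i m" "entry i k"]
                growing_take[OF gr, of k] am True k
              by (simp add: entry_def)
            then show False using entry_inj[OF Suc.prems(1), of m k] m k by auto
          qed
          then have "\<not> adj n (entry ?s m) (entry ?s (k - 1 + 1))" if "m \<in> {1..k - 1}" for m
            using that k by (subst (1 2) sw) auto
          then show ?thesis
            using E_eq_zero_if_isolated[OF swap_closed[OF Suc.prems(1) k(1)], of "k - 1"] False k
            by auto
        qed
        then have P0: "P k \<otimes> P k \<otimes> E i = \<zero>" by (rule P_sq_E_eq_zero[OF k(1) Suc.prems(1)])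
        have YE: "Y k \<otimes> E i \<in> carrier R" "Y (k + 1) \<otimes> E i \<in> carrier R"
          using k Suc.prems by auto
        \<comment> \<open>The positions satisfy 0 < k and k + 1 < n, so n is at least 3 and there is
          no double arrow.\<close>
        have "n \<noteq> 2" using Suc.prems k by auto
        then consider "arrow n (entry i k) (entry i (k + 1))" "\<not> arrow n (entry i (k + 1)) (entry i k)"
          | "\<not> arrow n (entry i k) (entry i (k + 1))" "arrow n (entry i (k + 1)) (entry i k)"
          using True arrow_both_imp unfolding adj_def by blast
        then have "Y (k + 1) \<otimes> E i = Y k \<otimes> E i"
        proof cases
          case 1
          then have "(Y (k + 1) \<ominus> Y k) \<otimes> E i = \<zero>" using P_sq_right[OF k(1) Suc.prems(1)] P0 by simp
          then have "Y (k + 1) \<otimes> E i \<ominus> Y k \<otimes> E i = \<zero>"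
            using k Suc.prems by (simp add: minus_eq l_distr l_minus)
          then show ?thesis by (rule minus_eq_zero_imp_eq[OF YE(2,1)])
        next
          case 2
          then have "(Y k \<ominus> Y (k + 1)) \<otimes> E i = \<zero>" using P_sq_left[OF k(1) Suc.prems(1)] P0 by simp
          then have "Y k \<otimes> E i \<ominus> Y (k + 1) \<otimes> E i = \<zero>"
            using k Suc.prems by (simp add: minus_eq l_distr l_minus)
          then show ?thesis by (rule minus_eq_zero_imp_eq[OF YE, symmetric])
        qed
        also have "\<dots> = \<zero>" using k by (intro Suc.IH Suc.prems) auto
        finally show ?thesis by simp
      qed
    qed
  qed
qed simp

text \<open>Up to sign, either e(i) or y_n e(i) equals \<psi>_{n-1} e(s i) \<psi>_{n-1}, because
  y_{n-1} e(i) = 0. A further y_n slides past \<psi>_{n-1}, becomes y_{n-1} and annihilates e(s i).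
  The double arrow, which forces n = 2, is treated separately.\<close>

lemma Y_last_sq_E:
  assumes "i \<in> residue_seqs n"
  shows "Y n \<otimes> (Y n \<otimes> E i) = \<zero>"
proof -
  define k where "k = n - 1"
  let ?s = "swap_entries k i"
  have nk: "n = k + 1" and k: "k \<in> {1..n - 1}" "k \<in> {1..n}" "k + 1 \<in> {1..n}" "0 < k" "k < n"
    using n_gt_1 by (auto simp: k_def)
  have car: "Y k \<in> carrier R" "Y (k + 1) \<in> carrier R" "P k \<in> carrier R" "E i \<in> carrier R"
    "E ?s \<in> carrier R" using k assms by simp_all
  have YP: "Y (k + 1) \<otimes> (P k \<otimes> E ?s \<otimes> P k) = \<zero>"
  proof -
    have "Y (k + 1) \<otimes> (P k \<otimes> E ?s \<otimes> P k) = Y (k + 1) \<otimes> P k \<otimes> (E ?s \<otimes> P k)"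
      using car by (simp add: m_assoc)
    also have "\<dots> = P k \<otimes> (Y k \<otimes> E ?s) \<otimes> P k"
      unfolding Suc_Y_P[OF k(1)] using car by (simp add: m_assoc)
    also have "\<dots> = \<zero>"
      using Y_E_eq_zero[OF swap_closed[OF assms k(1)] k(4,5)] car by simp
    finally show ?thesis .
  qed
  have PP: "P k \<otimes> P k \<otimes> E i = P k \<otimes> E ?s \<otimes> P k"
    using car P_E[OF k(1) assms] by (simp add: m_assoc)
  have Yk: "Y k \<otimes> E i = \<zero>" by (rule Y_E_eq_zero[OF assms k(4,5)])
  consider "\<not> adj n (entry i k) (entry i (k + 1))"
    | "arrow n (entry i k) (entry i (k + 1))" "\<not> arrow n (entry i (k + 1)) (entry i k)"
    | "\<not> arrow n (entry i k) (entry i (k + 1))" "arrow n (entry i (k + 1)) (entry i k)"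
    | "arrow n (entry i k) (entry i (k + 1))" "arrow n (entry i (k + 1)) (entry i k)"
    unfolding adj_def by blast
  then have "Y (k + 1) \<otimes> (Y (k + 1) \<otimes> E i) = \<zero>"
  proof cases
    case 1
    then show ?thesis using E_eq_P_E_P[OF k(1) assms] YP car by simp
  next
    case 2
    have "Y (k + 1) \<otimes> E i = P k \<otimes> E ?s \<otimes> P k"
      using P_sq_right[OF k(1) assms 2] PP Yk car by (simp add: minus_eq l_distr l_minus)
    then show ?thesis using YP car by simp
  next
    case 3
    have "\<ominus> (Y (k + 1) \<otimes> E i) = P k \<otimes> E ?s \<otimes> P k"
      using P_sq_left[OF k(1) assms 3] PP Yk car by (simp add: minus_eq l_distr l_minus)
    then have "Y (k + 1) \<otimes> E i = \<ominus> (P k \<otimes> E ?s \<otimes> P k)"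
      using car by (metis minus_minus m_closed)
    then show ?thesis using YP car by (simp add: r_minus)
  next
    case 4
    then have "n = 2" by (rule arrow_both_imp)
    then have "k = 1" using nk by simp
    have "E i = \<zero> \<or> E ?s = \<zero>"
    proof -
      have "entry i 1 \<noteq> entry i 2" using entry_inj[OF assms, of 1 2] n_gt_1 by auto
      moreover have "entry ?s 1 = entry i 2"
        using \<open>k = 1\<close> n_gt_1 by (subst entry_swap[OF assms k(1)]) (auto simp: numeral_2_eq_2)
      ultimately show ?thesis
        using cyc_E[OF assms] cyc_E[OF swap_closed[OF assms k(1)]] by metis
    qed
    then show ?thesis
    proof
      \<comment> \<open>The left side of the double-arrow relation is now 0; since y_1 e(i) = 0, its
        right side reduces to -y_2^2 e(i).\<close>
      assume "E ?s = \<zero>"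
      then have q: "(Y (k + 1) \<ominus> Y k) \<otimes> (Y k \<ominus> Y (k + 1)) \<otimes> E i = \<zero>"
        using P_sq_both[OF k(1) assms 4] PP car by simp
      have "(Y (k + 1) \<ominus> Y k) \<otimes> (Y k \<ominus> Y (k + 1)) \<otimes> E i
        = (Y (k + 1) \<ominus> Y k) \<otimes> \<ominus> (Y (k + 1) \<otimes> E i)"
        using car Yk by (simp add: m_assoc minus_eq l_distr l_minus)
      also have "\<dots> = \<ominus> (Y (k + 1) \<otimes> (Y (k + 1) \<otimes> E i)) \<oplus> Y (k + 1) \<otimes> (Y k \<otimes> E i)"
      proof -
        have "Y k \<otimes> (Y (k + 1) \<otimes> E i) = Y (k + 1) \<otimes> (Y k \<otimes> E i)"
          using car Y_Y[OF k(2,3)] by (simp add: m_assoc[symmetric])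
        then show ?thesis using car by (simp add: minus_eq l_distr l_minus r_minus local.minus_add)
      qed
      finally have "\<ominus> (Y (k + 1) \<otimes> (Y (k + 1) \<otimes> E i)) = \<zero>" unfolding q Yk using car by simp
      then show ?thesis using car by (metis minus_minus minus_zero m_closed)
    qed (use car in simp)
  qed
  then show ?thesis using nk by simp
qed

subsection \<open>Straightening and corners\<close>

lemma C_zero: "C 0 = \<zero>"
  using C_add[of 0 0] by (metis C_closed add.l_cancel_one' add_0)

lemma C_uminus_one_mult: "x \<in> carrier R \<Longrightarrow> C (- 1) \<otimes> x = \<ominus> x"
proof -
  assume x: "x \<in> carrier R"
  have "C (- 1) \<oplus> \<one> = \<zero>" using C_add[of "- 1" 1] by (simp add: C_zero C_one)
  then have "C (- 1) = \<ominus> \<one>" by (metis C_closed minus_equality one_closed)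
  then show ?thesis using x by (simp add: l_minus)
qed

section \<open>The chain of subalgebras using an initial set of \<psi>'s\<close>

text \<open>The analogue of the subgroup S_m of S_n: only \<psi>_k with k < m occur, but all y's and
  idempotents do. At m = 1 no \<psi> is left; at m = n it is the whole ring.\<close>

inductive_set klr_sub :: "nat \<Rightarrow> 'a set" for m where
  one: "\<one> \<in> klr_sub m"
| add: "\<lbrakk>x \<in> klr_sub m; z \<in> klr_sub m\<rbrakk> \<Longrightarrow> x \<oplus> z \<in> klr_sub m"
| C: "x \<in> klr_sub m \<Longrightarrow> C c \<otimes> x \<in> klr_sub m"
| E: "\<lbrakk>i \<in> residue_seqs n; x \<in> klr_sub m\<rbrakk> \<Longrightarrow> E i \<otimes> x \<in> klr_sub m"
| Y: "\<lbrakk>k \<in> {1..n}; x \<in> klr_sub m\<rbrakk> \<Longrightarrow> Y k \<otimes> x \<in> klr_sub m"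
| P: "\<lbrakk>k \<in> {1..<m}; x \<in> klr_sub m\<rbrakk> \<Longrightarrow> P k \<otimes> x \<in> klr_sub m"

lemma klr_sub_closed: "x \<in> klr_sub m \<Longrightarrow> m \<le> n \<Longrightarrow> x \<in> carrier R"
  by (induction rule: klr_sub.induct) (auto intro!: m_closed P_closed')

lemma klr_sub_n: "carrier R \<subseteq> klr_sub n"
  by (rule generation) (auto intro: klr_sub.intros klr_sub_closed)

lemma klr_sub_mult:
  assumes "x \<in> klr_sub m" "z \<in> klr_sub m" "m \<le> n"
  shows "x \<otimes> z \<in> klr_sub m"
  using assms(1)
proof (induction rule: klr_sub.induct)
  case one
  then show ?case using assms klr_sub_closed by simp
next
  case (add x y)
  then show ?case using assms klr_sub_closed by (simp add: l_distr klr_sub.add)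
next
  case (P k x)
  then have "P k \<in> carrier R" using assms by (intro P_closed') auto
  then show ?case
    using P assms klr_sub_closed klr_sub.P[OF P.hyps(1) P.IH] by (simp add: m_assoc)
qed (use assms klr_sub_closed in \<open>auto simp: m_assoc intro: klr_sub.intros\<close>)

lemma zero_klr_sub: "\<zero> \<in> klr_sub m"
  using klr_sub.C[OF klr_sub.one, of 0 m] by (simp add: C_zero)

lemma finsum_klr_sub:
  assumes "finite A" "\<And>x. x \<in> A \<Longrightarrow> f x \<in> klr_sub m" "m \<le> n"
  shows "finsum R f A \<in> klr_sub m"
  using assms
proof (induction A rule: finite_induct)
  case (insert x A)
  then have "finsum R f (insert x A) = f x \<oplus> finsum R f A"
    by (intro finsum_insert) (auto intro: klr_sub_closed)
  with insert show ?case by (simp add: klr_sub.add)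
qed (simp add: zero_klr_sub)

lemma minus_klr_sub:
  assumes "x \<in> klr_sub m" "z \<in> klr_sub m" "m \<le> n"
  shows "x \<ominus> z \<in> klr_sub m"
  using assms klr_sub.C[OF assms(2), of "- 1"]
  by (simp add: C_uminus_one_mult klr_sub_closed minus_eq klr_sub.add)

text \<open>On each e(i) the quadratic relation replaces \<psi>_k^2 by a polynomial in the y's, so a
  double crossing can be removed during straightening.\<close>

lemma P_sq_klr_sub:
  assumes k: "k \<in> {1..n - 1}"
  shows "P k \<otimes> P k \<in> klr_sub 1"
proof -
  have kn: "k \<in> {1..n}" "k + 1 \<in> {1..n}" using k by auto
  have E: "E i \<in> klr_sub 1" if "i \<in> residue_seqs n" for i
    using klr_sub.E[OF that klr_sub.one, of 1] that by simp
  have Y: "Y l \<in> klr_sub 1" if "l \<in> {1..n}" for l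
    using klr_sub.Y[OF that klr_sub.one, of 1] that by (simp del: One_nat_def)
  have "P k \<otimes> P k = (\<Oplus>i\<in>residue_seqs n. P k \<otimes> P k \<otimes> E i)"
    using k E_sum finsum_rdistr[of "residue_seqs n" "P k \<otimes> P k" E] by auto
  also have "\<dots> \<in> klr_sub 1"
  proof (rule finsum_klr_sub)
    fix i assume i: "i \<in> residue_seqs n"
    consider "\<not> arrow n (entry i k) (entry i (k + 1))" "\<not> arrow n (entry i (k + 1)) (entry i k)"
      | "arrow n (entry i k) (entry i (k + 1))" "\<not> arrow n (entry i (k + 1)) (entry i k)"
      | "\<not> arrow n (entry i k) (entry i (k + 1))" "arrow n (entry i (k + 1)) (entry i k)"
      | "arrow n (entry i k) (entry i (k + 1))" "arrow n (entry i (k + 1)) (entry i k)"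
      by blast
    then show "P k \<otimes> P k \<otimes> E i \<in> klr_sub 1"
    proof cases
      case 1
      show ?thesis unfolding P_sq_none[OF k i 1] by (rule E[OF i])
    next
      case 2
      show ?thesis unfolding P_sq_right[OF k i 2]
        using n_gt_1 by (intro klr_sub_mult minus_klr_sub E Y i kn) auto
    next
      case 3
      show ?thesis unfolding P_sq_left[OF k i 3]
        using n_gt_1 by (intro klr_sub_mult minus_klr_sub E Y i kn) auto
    next
      case 4
      show ?thesis unfolding P_sq_both[OF k i 4]
        using n_gt_1 by (intro klr_sub_mult minus_klr_sub E Y i kn) auto
    qed
  qed (use n_gt_1 in auto)
  finally show ?thesis .
qed

section \<open>Coset words and straightening\<close>

text \<open>The word \<psi>_a \<psi>_{a+1} ... with d letters. For a + d = m + 1 these spell the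
  minimal representatives of the left cosets of S_m in S_{m+1}; d = 0 gives the trivial
  coset.\<close>

primrec run :: "nat \<Rightarrow> nat \<Rightarrow> 'a" where
  "run a 0 = \<one>"
| "run a (Suc d) = P a \<otimes> run (Suc a) d"

lemma run_closed [simp]: "0 < a \<Longrightarrow> a + d \<le> n \<Longrightarrow> run a d \<in> carrier R"
  by (induction d arbitrary: a) auto

text \<open>Each letter pushes the residue that was at position a one place further right. Its final
  position is what later rules out nontrivial runs in a corner.\<close>

lemma E_run:
  assumes "i \<in> residue_seqs n" "0 < a" "a + d \<le> n"
  shows "\<exists>j\<in>residue_seqs n. entry j (a + d) = entry i a \<and> E i \<otimes> run a d = run a d \<otimes> E j"
  using assms
proof (induction d arbitrary: a i)
  case (Suc d)
  have a: "a \<in> {1..n - 1}" and s: "swap_entries a i \<in> residue_seqs n" using Suc.prems by auto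
  from Suc.IH[OF s, of "Suc a"] Suc.prems obtain j where j: "j \<in> residue_seqs n"
    "entry j (a + Suc d) = entry (swap_entries a i) (Suc a)"
    "E (swap_entries a i) \<otimes> run (Suc a) d = run (Suc a) d \<otimes> E j" by auto
  have "E i \<otimes> (P a \<otimes> run (Suc a) d) = E i \<otimes> P a \<otimes> run (Suc a) d"
    using a s Suc.prems by (simp add: m_assoc)
  also have "\<dots> = P a \<otimes> (E (swap_entries a i) \<otimes> run (Suc a) d)"
    using a s Suc.prems by (simp add: E_P[OF a Suc.prems(1)] m_assoc)
  also have "\<dots> = P a \<otimes> run (Suc a) d \<otimes> E j"
    using j a Suc.prems by (simp add: m_assoc)
  finally show ?case
    using j entry_swap[OF Suc.prems(1) a, of "Suc a"] Suc.prems by (intro bexI[of _ j]) auto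
qed auto

text \<open>Passing a \<psi> changes only the index of y, as there are no correction terms.\<close>

lemma Y_run:
  assumes "k \<in> {1..n}" "0 < a" "a + d \<le> n"
  shows "\<exists>l\<in>{1..n}. Y k \<otimes> run a d = run a d \<otimes> Y l"
  using assms
proof (induction d arbitrary: a k)
  case (Suc d)
  have a: "a \<in> {1..n - 1}" using Suc.prems by auto
  have "\<exists>k'\<in>{1..n}. Y k \<otimes> P a = P a \<otimes> Y k'"
  proof -
    consider "k = a" | "k = a + 1" | "k \<noteq> a" "k \<noteq> a + 1" by blast
    then show ?thesis
    proof cases
      case 1 then show ?thesis using P_Suc_Y[OF a] a by (intro bexI[of _ "a + 1"]) auto
    next
      case 2 then show ?thesis using Suc_Y_P[OF a] a by (intro bexI[of _ a]) auto
    next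
      case 3 then show ?thesis using P_Y[OF a Suc.prems(1)] Suc.prems by (intro bexI[of _ k]) auto
    qed
  qed
  then obtain k' where k': "k' \<in> {1..n}" "Y k \<otimes> P a = P a \<otimes> Y k'" by blast
  from Suc.IH[OF k'(1), of "Suc a"] Suc.prems obtain l where
    l: "l \<in> {1..n}" "Y k' \<otimes> run (Suc a) d = run (Suc a) d \<otimes> Y l" by auto
  have car: "Y k \<in> carrier R" "Y k' \<in> carrier R" "Y l \<in> carrier R" "P a \<in> carrier R"
    "run (Suc a) d \<in> carrier R"
    using Suc.prems a k'(1) l(1) by simp_all
  have "Y k \<otimes> (P a \<otimes> run (Suc a) d) = Y k \<otimes> P a \<otimes> run (Suc a) d"
    using car by (simp add: m_assoc)
  also have "\<dots> = P a \<otimes> (Y k' \<otimes> run (Suc a) d)"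
    using car by (simp add: k' m_assoc)
  also have "\<dots> = P a \<otimes> run (Suc a) d \<otimes> Y l"
    using car by (simp add: l m_assoc)
  finally show ?case using l(1) by (intro bexI[of _ l]) simp_all
qed auto

lemma C_run:
  assumes "0 < a" "a + d \<le> n"
  shows "C c \<otimes> run a d = run a d \<otimes> C c"
  using assms
proof (induction d arbitrary: a)
  case (Suc d)
  then have car: "P a \<in> carrier R" "run (Suc a) d \<in> carrier R" and a: "a \<in> {1..n - 1}" by auto
  have "C c \<otimes> (P a \<otimes> run (Suc a) d) = P a \<otimes> (C c \<otimes> run (Suc a) d)"
    using car C_P[OF a] by (simp add: m_assoc[symmetric])
  then show ?case using car Suc by (simp add: m_assoc)
qed auto

lemma P_run_far:
  assumes "0 < k" "k + 1 < a" "a + d \<le> n"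
  shows "P k \<otimes> run a d = run a d \<otimes> P k"
  using assms
proof (induction d arbitrary: a)
  case (Suc d)
  then have car: "P k \<in> carrier R" "P a \<in> carrier R" "run (Suc a) d \<in> carrier R" by auto
  have "P k \<otimes> P a = P a \<otimes> P k" using Suc.prems by (intro P_P) auto
  then have "P k \<otimes> (P a \<otimes> run (Suc a) d) = P a \<otimes> (P k \<otimes> run (Suc a) d)"
    using car by (simp add: m_assoc[symmetric])
  then show ?case using car Suc by (simp add: m_assoc)
qed auto

text \<open>\<psi>_k commutes with the letters until it meets \<psi>_{k-1} \<psi>_k; the braid
  relation turns it into \<psi>_{k-1}, which commutes with the rest.\<close>

lemma P_run_shift:
  assumes "0 < a" "a < k" "k < a + d" "a + d \<le> n"
  shows "P k \<otimes> run a d = run a d \<otimes> P (k - 1)"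
  using assms
proof (induction d arbitrary: a)
  case (Suc d)
  then have car: "P k \<in> carrier R" "P a \<in> carrier R" "P (k - 1) \<in> carrier R"
    "run (Suc a) d \<in> carrier R" by (auto intro: P_closed')
  show ?case
  proof (cases "k = a + 1")
    case True
    then obtain d' where d': "d = Suc d'" using Suc.prems by (cases d) auto
    have car': "run (Suc (Suc a)) d' \<in> carrier R" "P (Suc a) \<in> carrier R"
      using Suc.prems d' by auto
    have "P (a + 1) \<otimes> (P a \<otimes> P (a + 1)) = P a \<otimes> (P (a + 1) \<otimes> P a)"
      using Suc.prems d' by (intro P_braid) auto
    then have "P (Suc a) \<otimes> (P a \<otimes> P (Suc a)) \<otimes> run (Suc (Suc a)) d'
        = P a \<otimes> (P (Suc a) \<otimes> P a) \<otimes> run (Suc (Suc a)) d'" by simp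
    then have "P k \<otimes> run a (Suc d) = P a \<otimes> (P (Suc a) \<otimes> (P a \<otimes> run (Suc (Suc a)) d'))"
      using car car' d' True by (simp add: m_assoc)
    also have "P a \<otimes> run (Suc (Suc a)) d' = run (Suc (Suc a)) d' \<otimes> P a"
      using Suc.prems d' by (intro P_run_far) auto
    finally show ?thesis using car car' d' True by (simp add: m_assoc)
  next
    case False
    have "P k \<otimes> P a = P a \<otimes> P k" using Suc.prems False by (intro P_P) auto
    then have "P k \<otimes> (P a \<otimes> run (Suc a) d) = P a \<otimes> (P k \<otimes> run (Suc a) d)"
      using car by (simp add: m_assoc[symmetric])
    then show ?thesis using car Suc False by (simp add: m_assoc)
  qed
qed auto

text \<open>The sum of the right \<open>klr_sub m\<close>-modules generated by the coset words,
  mirroring the decomposition of S_{m+1} into cosets of S_m. It contains 1, so stability under left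
  multiplication by generators makes it contain \<open>klr_sub (Suc m)\<close>.\<close>

inductive_set run_span :: "nat \<Rightarrow> 'a set" for m where
  run: "\<lbrakk>0 < a; a + d = m + 1; z \<in> klr_sub m\<rbrakk> \<Longrightarrow> run a d \<otimes> z \<in> run_span m"
| add: "\<lbrakk>x \<in> run_span m; z \<in> run_span m\<rbrakk> \<Longrightarrow> x \<oplus> z \<in> run_span m"

lemma run_span_closed: "x \<in> run_span m \<Longrightarrow> m < n \<Longrightarrow> x \<in> carrier R"
  by (induction rule: run_span.induct) (auto simp: klr_sub_closed)

lemma run_span_left:
  assumes "m < n" "x \<in> run_span m" "g \<in> carrier R"
    and "\<And>a d z. \<lbrakk>0 < a; a + d = m + 1; z \<in> klr_sub m\<rbrakk> \<Longrightarrow> g \<otimes> (run a d \<otimes> z) \<in> run_span m"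
  shows "g \<otimes> x \<in> run_span m"
  using assms(2)
proof (induction rule: run_span.induct)
  case (add x z)
  then show ?case using assms(1,3) run_span_closed by (simp add: r_distr run_span.add)
qed (rule assms(4))

lemma run_span_left_move:
  assumes "m < n" "g \<in> carrier R" "g' \<in> carrier R" "0 < a" "a + d = m + 1" "z \<in> klr_sub m"
    and "g \<otimes> run a d = run a d \<otimes> g'" "g' \<otimes> z \<in> klr_sub m"
  shows "g \<otimes> (run a d \<otimes> z) \<in> run_span m"
proof -
  have car: "run a d \<in> carrier R" "z \<in> carrier R" using assms klr_sub_closed[of z m] by auto
  then have "g \<otimes> (run a d \<otimes> z) = run a d \<otimes> (g' \<otimes> z)"
    using assms(2,3,7) by (simp add: m_assoc[symmetric])
  then show ?thesis using run_span.run[OF assms(4,5,8)] by simp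
qed

lemma E_run_span:
  assumes "m < n" "x \<in> run_span m" "i \<in> residue_seqs n"
  shows "E i \<otimes> x \<in> run_span m"
proof (rule run_span_left[OF assms(1,2)])
  fix a d z assume *: "0 < a" "a + d = m + 1" "z \<in> klr_sub m"
  with E_run[OF assms(3), of a d] assms(1) obtain j
    where "j \<in> residue_seqs n" "E i \<otimes> run a d = run a d \<otimes> E j" by auto
  with * assms show "E i \<otimes> (run a d \<otimes> z) \<in> run_span m"
    by (intro run_span_left_move[of m _ "E j"]) (auto intro: klr_sub.E)
qed (use assms in simp)

lemma Y_run_span:
  assumes "m < n" "x \<in> run_span m" "k \<in> {1..n}"
  shows "Y k \<otimes> x \<in> run_span m"
proof (rule run_span_left[OF assms(1,2)])
  fix a d z assume *: "0 < a" "a + d = m + 1" "z \<in> klr_sub m"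
  with Y_run[OF assms(3), of a d] assms(1) obtain j
    where j: "j \<in> {1..n}" "Y k \<otimes> run a d = run a d \<otimes> Y j" by auto
  show "Y k \<otimes> (run a d \<otimes> z) \<in> run_span m"
    by (rule run_span_left_move[OF assms(1) Y_closed[OF assms(3)] Y_closed[OF j(1)] * j(2)
        klr_sub.Y[OF j(1) *(3)]])
qed (use assms in simp)

lemma C_run_span:
  assumes "m < n" "x \<in> run_span m"
  shows "C c \<otimes> x \<in> run_span m"
proof (rule run_span_left[OF assms(1,2)])
  fix a d z assume *: "0 < a" "a + d = m + 1" "z \<in> klr_sub m"
  with C_run[of a d] assms(1) have "C c \<otimes> run a d = run a d \<otimes> C c" by auto
  then show "C c \<otimes> (run a d \<otimes> z) \<in> run_span m"
    by (rule run_span_left_move[OF assms(1) C_closed C_closed * _ klr_sub.C[OF *(3)]])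
qed simp

lemma klr_sub_1_run_span:
  assumes "m < n" "x \<in> klr_sub 1" "z \<in> run_span m"
  shows "x \<otimes> z \<in> run_span m"
  using assms(2)
proof (induction rule: klr_sub.induct)
  case one
  then show ?case using assms run_span_closed by simp
next
  case (add x y)
  then show ?case using assms klr_sub_closed[of _ 1] run_span_closed n_gt_1
    by (simp add: l_distr run_span.add)
next
  case (C x c)
  then show ?case using assms klr_sub_closed[of _ 1] run_span_closed n_gt_1
    by (simp add: m_assoc C_run_span)
next
  case (E i x)
  then show ?case using assms klr_sub_closed[of _ 1] run_span_closed n_gt_1
    by (simp add: m_assoc E_run_span)
next
  case (Y k x)
  then have "Y k \<otimes> x \<otimes> z = Y k \<otimes> (x \<otimes> z)"
    using assms klr_sub_closed[of x 1] run_span_closed n_gt_1 by (simp add: m_assoc)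
  then show ?case using Y_run_span[OF assms(1) Y.IH Y.hyps(1)] by simp
next
  case (P k x)
  then show ?case by simp
qed

text \<open>Left multiplication by a simple transposition on cosets of S_m: it lengthens the
  representative, shortens it, or fixes the coset and emerges on the right as a generator of
  S_m.\<close>

lemma P_run_span:
  assumes "m < n" "x \<in> run_span m" "k \<in> {1..m}"
  shows "P k \<otimes> x \<in> run_span m"
proof (rule run_span_left[OF assms(1,2)])
  have k: "k \<in> {1..n - 1}" using assms by auto
  then show Pk: "P k \<in> carrier R" by simp
  fix a d z assume *: "0 < a" "a + d = m + 1" "z \<in> klr_sub m"
  have z: "z \<in> carrier R" using * assms(1) klr_sub_closed[of z m] by simp
  have ad: "a + d \<le> n" using * assms(1) by simp
  consider "k + 1 < a" | "a = k + 1" | "k = a" | "a < k" by linarith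
  then show "P k \<otimes> (run a d \<otimes> z) \<in> run_span m"
  proof cases
    case 1
    then show ?thesis
      using assms(3) * by (intro run_span_left_move[OF assms(1) Pk Pk *] P_run_far ad klr_sub.P) auto
  next
    case 2
    then have "P k \<otimes> (run a d \<otimes> z) = run k (Suc d) \<otimes> z"
      using Pk z run_closed[OF *(1) ad] by (simp add: m_assoc)
    then show ?thesis using run_span.run[of k "Suc d" m z] 2 * assms(3) by simp
  next
    case 3
    \<comment> \<open>The run starts with \<psi>_k itself; the resulting square contains no \<psi>,
      and a shorter run remains.\<close>
    then obtain d' where d': "d = Suc d'" using * assms(3) by (cases d) auto
    have c: "run (Suc a) d' \<in> carrier R" using d' ad by simp
    have "P k \<otimes> (run a d \<otimes> z) = P k \<otimes> P k \<otimes> (run (Suc a) d' \<otimes> z)"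
      using 3 d' c Pk z by (simp add: m_assoc)
    then show ?thesis
      using klr_sub_1_run_span[OF assms(1) P_sq_klr_sub[OF k]] run_span.run[of "Suc a" d' m z] d' *
      by simp
  next
    case 4
    have k1: "k - 1 \<in> {1..<m}" using 4 * assms(3) by auto
    have P1: "P (k - 1) \<in> carrier R" using k1 assms(1) by (intro P_closed) auto
    show ?thesis
      using 4 * assms(3)
      by (intro run_span_left_move[OF assms(1) Pk P1 *] P_run_shift ad klr_sub.P[OF k1]) auto
  qed
qed

lemma klr_sub_Suc_subset:
  assumes "m < n"
  shows "klr_sub (Suc m) \<subseteq> run_span m"
proof
  fix x assume "x \<in> klr_sub (Suc m)"
  then show "x \<in> run_span m"
  proof (induction rule: klr_sub.induct)
    case one
    then show ?case using run_span.run[OF _ _ klr_sub.one, of "m + 1" 0 m] by simp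
  next
    case (P k x)
    then show ?case using P_run_span[OF assms P.IH] by (auto simp: less_Suc_eq_le)
  qed (use assms in \<open>auto intro: run_span.add C_run_span E_run_span Y_run_span\<close>)
qed

section \<open>The corners e(i) R e(i)\<close>

text \<open>The \<psi>_k with k < m permute only the first m positions, so the residue at a later
  position l is preserved.\<close>

lemma E_klr_sub_E_eq_zero:
  assumes "x \<in> klr_sub m" "m < l" "l \<le> n" "i \<in> residue_seqs n" "j \<in> residue_seqs n"
    "entry j l \<noteq> entry i l"
  shows "E j \<otimes> (x \<otimes> E i) = \<zero>"
  using assms(1,5,6)
proof (induction arbitrary: j rule: klr_sub.induct)
  case one
  then show ?case using assms by (auto simp: E_E)
next
  case (add x z)
  then show ?case using assms klr_sub_closed[of _ m] by (simp add: l_distr r_distr)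
next
  case (C x c)
  then have x: "x \<otimes> E i \<in> carrier R" "x \<in> carrier R" using assms klr_sub_closed[of _ m] by auto
  have "E j \<otimes> (C c \<otimes> x \<otimes> E i) = C c \<otimes> (E j \<otimes> (x \<otimes> E i))"
    using x C_E[of j c] assms C.prems by (simp add: m_assoc[symmetric])
  then show ?case using C by simp
next
  case (E k x)
  then have x: "x \<otimes> E i \<in> carrier R" "x \<in> carrier R" using assms klr_sub_closed[of _ m] by auto
  have "E j \<otimes> (E k \<otimes> x \<otimes> E i) = (if j = k then E j else \<zero>) \<otimes> (x \<otimes> E i)"
    using x assms E by (simp add: m_assoc[symmetric] E_E)
  then show ?case using E x by (cases "j = k") simp_all
next
  case (Y k x)
  then have x: "x \<otimes> E i \<in> carrier R" "x \<in> carrier R" "Y k \<in> carrier R" "E j \<in> carrier R"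
    using assms klr_sub_closed[of _ m] by auto
  have "E j \<otimes> (Y k \<otimes> x \<otimes> E i) = E j \<otimes> Y k \<otimes> (x \<otimes> E i)"
    using x assms by (simp add: m_assoc)
  also have "\<dots> = Y k \<otimes> (E j \<otimes> (x \<otimes> E i))"
    using x assms Y_E[OF Y.hyps(1) Y.prems(1)] by (simp add: m_assoc[symmetric])
  finally show ?case using Y.IH[OF Y.prems] x by simp
next
  case (P k x)
  have k: "k \<in> {1..n - 1}" using P.hyps assms by auto
  let ?s = "swap_entries k j"
  have x: "x \<otimes> E i \<in> carrier R" "x \<in> carrier R" "P k \<in> carrier R" "E j \<in> carrier R"
    "E ?s \<in> carrier R"
    using P assms k klr_sub_closed[of _ m] by auto
  have "E j \<otimes> (P k \<otimes> x \<otimes> E i) = E j \<otimes> P k \<otimes> (x \<otimes> E i)"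
    using x assms by (simp add: m_assoc)
  also have "\<dots> = P k \<otimes> (E ?s \<otimes> (x \<otimes> E i))"
    unfolding E_P[OF k P.prems(1)] using x by (simp add: m_assoc)
  also have "entry ?s l = entry j l"
    using P.hyps assms by (subst entry_swap[OF P.prems(1) k]) auto
  then have "E ?s \<otimes> (x \<otimes> E i) = \<zero>" using P.IH[of ?s] P.prems k by simp
  finally show ?case using x by simp
qed

text \<open>A nontrivial run needs the residue i_a at position m + 1 of the sequence reached from
  e(i) by its right factor in \<open>klr_sub m\<close>. That factor cannot change position m + 1,
  where i has a different residue. Only the empty run survives.\<close>

lemma corner_klr_sub_Suc:
  assumes "m < n" "i \<in> residue_seqs n" "x \<in> klr_sub (Suc m)"
  shows "\<exists>x'\<in>klr_sub m. E i \<otimes> (x \<otimes> E i) = E i \<otimes> (x' \<otimes> E i)"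
proof -
  from assms have "x \<in> run_span m" using klr_sub_Suc_subset by blast
  then show ?thesis
  proof (induction rule: run_span.induct)
    case (run a d z)
    have z: "z \<in> carrier R" using run assms klr_sub_closed[of z m] by simp
    show ?case
    proof (cases "d = 0")
      case True
      then show ?thesis using run z by auto
    next
      case False
      have ad: "a + d \<le> n" using run assms by simp
      obtain j where j: "j \<in> residue_seqs n" "entry j (a + d) = entry i a"
        "E i \<otimes> run a d = run a d \<otimes> E j"
        using E_run[OF assms(2) run(1) ad] by blast
      \<comment> \<open>Distinctness of the residues is decisive: i_a at position a + d > a cannot
        be the residue that i has there.\<close>
      have "entry j (a + d) \<noteq> entry i (a + d)"
        using entry_inj[OF assms(2), of a "a + d"] j(2) False ad run by auto
      then have "E j \<otimes> (z \<otimes> E i) = \<zero>"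
        using E_klr_sub_E_eq_zero[OF run(3) _ ad assms(2) j(1)] run by simp
      moreover have "E i \<otimes> (run a d \<otimes> z \<otimes> E i) = E i \<otimes> run a d \<otimes> (z \<otimes> E i)"
        using z assms run ad by (simp add: m_assoc)
      moreover have "\<dots> = run a d \<otimes> (E j \<otimes> (z \<otimes> E i))"
        unfolding j(3) using z assms run ad j by (simp add: m_assoc)
      ultimately have "E i \<otimes> (run a d \<otimes> z \<otimes> E i) = E i \<otimes> (\<zero> \<otimes> E i)"
        using run ad assms by simp
      then show ?thesis using zero_klr_sub by blast
    qed
  next
    case (add x z)
    then obtain x' z' where *: "x' \<in> klr_sub m" "z' \<in> klr_sub m"
      "E i \<otimes> (x \<otimes> E i) = E i \<otimes> (x' \<otimes> E i)" "E i \<otimes> (z \<otimes> E i) = E i \<otimes> (z' \<otimes> E i)" by blast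
    have "x \<in> carrier R" "z \<in> carrier R" "x' \<in> carrier R" "z' \<in> carrier R"
      using add * assms run_span_closed klr_sub_closed[of _ m] by auto
    then have "E i \<otimes> ((x \<oplus> z) \<otimes> E i) = E i \<otimes> ((x' \<oplus> z') \<otimes> E i)"
      using * assms by (simp add: l_distr r_distr)
    then show ?case using * klr_sub.add by blast
  qed
qed

lemma corner_klr_sub:
  assumes "1 \<le> m" "m \<le> n" "i \<in> residue_seqs n" "x \<in> klr_sub m"
  shows "\<exists>x'\<in>klr_sub 1. E i \<otimes> (x \<otimes> E i) = E i \<otimes> (x' \<otimes> E i)"
  using assms
proof (induction m arbitrary: x rule: nat_induct_at_least)
  case (Suc m)
  obtain x' where "x' \<in> klr_sub m" "E i \<otimes> (x \<otimes> E i) = E i \<otimes> (x' \<otimes> E i)"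
    using corner_klr_sub_Suc[OF _ Suc.prems(2,3)] Suc.prems(1) by auto
  then show ?case using Suc.IH[OF _ Suc.prems(2)] Suc.prems(1) by auto
qed auto

lemma klr_sub_1_E:
  assumes "i \<in> residue_seqs n" "x \<in> klr_sub 1"
  shows "\<exists>a b. x \<otimes> E i = C a \<otimes> E i \<oplus> C b \<otimes> (Y n \<otimes> E i)"
  using assms(2)
proof (induction rule: klr_sub.induct)
  case one
  have "Y n \<in> carrier R" using n_gt_1 by simp
  then show ?case using assms by (intro exI[of _ 1] exI[of _ 0]) (simp add: C_one C_zero)
next
  case (add x z)
  then obtain a b a' b' where "x \<otimes> E i = C a \<otimes> E i \<oplus> C b \<otimes> (Y n \<otimes> E i)"
    "z \<otimes> E i = C a' \<otimes> E i \<oplus> C b' \<otimes> (Y n \<otimes> E i)" by blast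
  moreover have "Y n \<otimes> E i \<in> carrier R" "E i \<in> carrier R" using assms n_gt_1 by auto
  moreover have "x \<in> carrier R" "z \<in> carrier R" using add klr_sub_closed n_gt_1 by auto
  ultimately have "(x \<oplus> z) \<otimes> E i = C (a + a') \<otimes> E i \<oplus> C (b + b') \<otimes> (Y n \<otimes> E i)"
    by (simp add: l_distr C_add a_ac)
  then show ?case by blast
next
  case (C x c)
  then obtain a b where "x \<otimes> E i = C a \<otimes> E i \<oplus> C b \<otimes> (Y n \<otimes> E i)" by blast
  moreover have "Y n \<otimes> E i \<in> carrier R" "E i \<in> carrier R" using assms n_gt_1 by auto
  moreover have "x \<in> carrier R" using C klr_sub_closed n_gt_1 by auto
  ultimately have "C c \<otimes> x \<otimes> E i = C (c * a) \<otimes> E i \<oplus> C (c * b) \<otimes> (Y n \<otimes> E i)"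
    by (simp add: m_assoc r_distr C_mult)
  then show ?case by blast
next
  case (E j x)
  then obtain a b where ab: "x \<otimes> E i = C a \<otimes> E i \<oplus> C b \<otimes> (Y n \<otimes> E i)" by blast
  have n: "n \<in> {1..n}" using n_gt_1 by simp
  have car: "Y n \<in> carrier R" "E i \<in> carrier R" "E j \<in> carrier R" "x \<in> carrier R"
    using assms n E klr_sub_closed n_gt_1 by auto
  have "E j \<otimes> x \<otimes> E i = E j \<otimes> (x \<otimes> E i)" using car by (simp add: m_assoc)
  also have "\<dots> = E j \<otimes> C a \<otimes> E i \<oplus> E j \<otimes> C b \<otimes> (Y n \<otimes> E i)"
    unfolding ab using car by (simp add: r_distr m_assoc)
  also have "\<dots> = C a \<otimes> (E j \<otimes> E i) \<oplus> C b \<otimes> (E j \<otimes> Y n \<otimes> E i)"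
    using car E.hyps by (simp add: C_E[symmetric] m_assoc)
  also have "E j \<otimes> Y n \<otimes> E i = Y n \<otimes> (E j \<otimes> E i)"
    using car E.hyps n by (simp add: Y_E[symmetric] m_assoc)
  finally have *: "E j \<otimes> x \<otimes> E i = C a \<otimes> (E j \<otimes> E i) \<oplus> C b \<otimes> (Y n \<otimes> (E j \<otimes> E i))" .
  show ?case
  proof (cases "j = i")
    case True
    then show ?thesis using * assms by (auto simp: E_E)
  next
    case False
    then have "E j \<otimes> x \<otimes> E i = C 0 \<otimes> E i \<oplus> C 0 \<otimes> (Y n \<otimes> E i)"
      using * assms car E.hyps by (simp add: E_E C_zero)
    then show ?thesis by blast
  qed
next
  case (Y k x)
  then obtain a b where ab: "x \<otimes> E i = C a \<otimes> E i \<oplus> C b \<otimes> (Y n \<otimes> E i)" by blast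
  have n: "n \<in> {1..n}" using n_gt_1 by simp
  have car: "Y n \<in> carrier R" "E i \<in> carrier R" "Y k \<in> carrier R" "x \<in> carrier R"
    using assms n Y klr_sub_closed n_gt_1 by auto
  have "Y k \<otimes> x \<otimes> E i = Y k \<otimes> (x \<otimes> E i)" using car by (simp add: m_assoc)
  also have "\<dots> = Y k \<otimes> C a \<otimes> E i \<oplus> Y k \<otimes> C b \<otimes> (Y n \<otimes> E i)"
    unfolding ab using car by (simp add: r_distr m_assoc)
  also have "\<dots> = C a \<otimes> (Y k \<otimes> E i) \<oplus> C b \<otimes> (Y k \<otimes> Y n \<otimes> E i)"
    using car C_Y[OF Y.hyps(1), symmetric] by (simp add: m_assoc)
  also have "Y k \<otimes> Y n \<otimes> E i = Y n \<otimes> (Y k \<otimes> E i)"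
    using car Y_Y[OF Y.hyps(1) n] by (simp add: m_assoc)
  finally have *: "Y k \<otimes> x \<otimes> E i = C a \<otimes> (Y k \<otimes> E i) \<oplus> C b \<otimes> (Y n \<otimes> (Y k \<otimes> E i))" .
  show ?case
  proof (cases "k = n")
    case True
    then have "Y k \<otimes> x \<otimes> E i = C 0 \<otimes> E i \<oplus> C a \<otimes> (Y n \<otimes> E i)"
      using * car Y_last_sq_E[OF assms(1)] by (simp add: C_zero)
    then show ?thesis by blast
  next
    case False
    then have "Y k \<otimes> E i = \<zero>" using Y.hyps by (intro Y_E_eq_zero assms) auto
    then have "Y k \<otimes> x \<otimes> E i = C 0 \<otimes> E i \<oplus> C 0 \<otimes> (Y n \<otimes> E i)"
      using * car by (simp add: C_zero)
    then show ?thesis by blast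
  qed
next
  case (P k x)
  then show ?case by simp
qed

lemma corner:
  assumes "i \<in> residue_seqs n" "f \<in> carrier R"
  shows "\<exists>a b. E i \<otimes> (f \<otimes> E i) = C a \<otimes> E i \<oplus> C b \<otimes> (Y n \<otimes> E i)"
proof -
  have "f \<in> klr_sub n" using klr_sub_n assms by blast
  then obtain f' where f': "f' \<in> klr_sub 1" "E i \<otimes> (f \<otimes> E i) = E i \<otimes> (f' \<otimes> E i)"
    using corner_klr_sub[of n i f] assms n_gt_1 by auto
  have "E i \<otimes> (f' \<otimes> E i) = E i \<otimes> f' \<otimes> E i"
    using assms f' klr_sub_closed[of f' 1] n_gt_1 by (simp add: m_assoc)
  then show ?thesis using klr_sub_1_E[OF assms(1) klr_sub.E[OF assms(1) f'(1)]] f'(2) by simp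
qed

text \<open>With t = y_n e(i), central in the corner and of square 0, this is the product of a + b t
  and c + d t.\<close>

lemma dual_number_mult:
  assumes "i \<in> residue_seqs n"
  shows "(C a \<otimes> E i \<oplus> C b \<otimes> (Y n \<otimes> E i)) \<otimes> (C c \<otimes> E i \<oplus> C d \<otimes> (Y n \<otimes> E i))
    = C (a * c) \<otimes> E i \<oplus> C (a * d + b * c) \<otimes> (Y n \<otimes> E i)"
proof -
  define e x where "e = E i" and "x = Y n \<otimes> E i"
  have n: "n \<in> {1..n}" using n_gt_1 by simp
  have car: "e \<in> carrier R" "x \<in> carrier R" "Y n \<in> carrier R" "E i \<in> carrier R"
    using assms n by (auto simp: e_def x_def)
  have ee: "e \<otimes> e = e" using assms by (simp add: e_def E_E)
  have ex: "e \<otimes> x = x"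
    unfolding x_def Y_E[OF n assms] using car ee by (simp add: m_assoc[symmetric] e_def)
  have xe: "x \<otimes> e = x"
    unfolding x_def using car ee by (simp add: m_assoc e_def)
  have xx: "x \<otimes> x = \<zero>"
  proof -
    have "x \<otimes> x = Y n \<otimes> (E i \<otimes> x)" using car by (simp add: x_def m_assoc)
    then show ?thesis using ex Y_last_sq_E[OF assms] by (simp add: e_def x_def)
  qed
  have Ce: "C s \<otimes> e = e \<otimes> C s" for s using C_E[OF assms] by (simp add: e_def)
  have Cx: "C s \<otimes> x = x \<otimes> C s" for s
  proof -
    have "C s \<otimes> x = Y n \<otimes> (C s \<otimes> E i)"
      using car C_Y[OF n, of s] by (simp add: x_def m_assoc[symmetric])
    then show ?thesis using car C_E[OF assms] by (simp add: x_def m_assoc)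
  qed
  have move: "(C s \<otimes> u) \<otimes> (C t \<otimes> v) = C (s * t) \<otimes> (u \<otimes> v)"
    if "u \<in> carrier R" "v \<in> carrier R" "C t \<otimes> u = u \<otimes> C t" for s t u v
  proof -
    have "(C s \<otimes> u) \<otimes> (C t \<otimes> v) = C s \<otimes> (u \<otimes> C t) \<otimes> v" using that by (simp add: m_assoc)
    then show ?thesis unfolding that(3)[symmetric] using that(1,2) by (simp add: m_assoc C_mult)
  qed
  have "(C a \<otimes> e \<oplus> C b \<otimes> x) \<otimes> (C c \<otimes> e \<oplus> C d \<otimes> x)
    = C (a * c) \<otimes> e \<oplus> (C (a * d) \<otimes> x \<oplus> C (b * c) \<otimes> x)"
    using car by (simp add: l_distr r_distr move[OF car(1,1) Ce] move[OF car(1,2) Ce]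
        move[OF car(2,1) Cx] move[OF car(2,2) Cx] ee ex xe xx a_ac)
  also have "\<dots> = C (a * c) \<otimes> e \<oplus> C (a * d + b * c) \<otimes> x"
    using car by (simp add: C_add l_distr)
  finally show ?thesis by (simp add: e_def x_def)
qed

lemma primitive_E:
  assumes "i \<in> residue_seqs n" "E i \<noteq> \<zero>"
  shows "primitive_idempotent R (E i)"
  unfolding primitive_idempotent_def
proof (intro conjI allI impI)
  show "idempotent_elem R (E i)" using assms by (simp add: idempotent_elem_def E_E)
  show "E i \<noteq> \<zero>" by (rule assms(2))
  fix f g
  assume *: "idempotent_elem R f \<and> idempotent_elem R g \<and> orthogonal_elems R f g \<and> E i = f \<oplus> g"
  then have car: "f \<in> carrier R" "g \<in> carrier R" and ff: "f \<otimes> f = f" and gg: "g \<otimes> g = g"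
    and fg: "f \<otimes> g = \<zero>" "g \<otimes> f = \<zero>" and e: "E i = f \<oplus> g"
    by (auto simp: idempotent_elem_def orthogonal_elems_def)
  have n: "n \<in> {1..n}" using n_gt_1 by simp
  have x: "Y n \<otimes> E i \<in> carrier R" "E i \<in> carrier R" using assms n by auto
  \<comment> \<open>Orthogonal summands of e(i) satisfy e(i) f e(i) = f, so f lies in the corner and
    has dual-number coordinates.\<close>
  have "E i \<otimes> (f \<otimes> E i) = f" "g \<otimes> E i = g"
    unfolding e using car ff gg fg by (simp_all add: l_distr r_distr)
  with corner[OF assms(1) car(1)] obtain a b
    where f: "f = C a \<otimes> E i \<oplus> C b \<otimes> (Y n \<otimes> E i)" by auto
  show "f = \<zero> \<or> g = \<zero>"
  proof (cases "a = 0")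
    case True
    have "f \<otimes> f = \<zero>"
      using dual_number_mult[OF assms(1), of a b a b] True x unfolding f by (simp add: C_zero)
    then show ?thesis using ff by simp
  next
    case False
    \<comment> \<open>The inverse of a + b t among the dual numbers is 1/a - (b/a^2) t. Then f h =
      e(i), and g = g f h = 0 by orthogonality.\<close>
    define h where "h = C (1 / a) \<otimes> E i \<oplus> C (- (b / a\<^sup>2)) \<otimes> (Y n \<otimes> E i)"
    have h: "h \<in> carrier R" using x by (simp add: h_def)
    have "f \<otimes> h = C 1 \<otimes> E i \<oplus> C 0 \<otimes> (Y n \<otimes> E i)"
      unfolding f h_def dual_number_mult[OF assms(1)]
      using False by (simp add: power2_eq_square)
    then have "f \<otimes> h = E i" using x by (simp add: C_one C_zero)
    then have "g = g \<otimes> (f \<otimes> h)" using \<open>g \<otimes> E i = g\<close> by simp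
    also have "\<dots> = \<zero>" using car h fg by (simp add: m_assoc[symmetric])
    finally show ?thesis ..
  qed
qed

lemma complete_primitive_orthogonal:
  "complete_primitive_orthogonal_idempotents R {E i | i. i \<in> residue_seqs n \<and> E i \<noteq> \<zero>}"
proof -
  define S where "S = {i \<in> residue_seqs n. E i \<noteq> \<zero>}"
  have set: "{E i | i. i \<in> residue_seqs n \<and> E i \<noteq> \<zero>} = E ` S" by (auto simp: S_def)
  \<comment> \<open>The sum in the claim runs over the set of values, so equal nonzero idempotents
    must come from equal sequences; orthogonality ensures this.\<close>
  have inj: "inj_on E S"
  proof (rule inj_onI)
    fix i j assume ij: "i \<in> S" "j \<in> S" "E i = E j"
    then have S: "i \<in> residue_seqs n" "j \<in> residue_seqs n" "E i \<noteq> \<zero>" by (auto simp: S_def)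
    have "E i = E i \<otimes> E j" using E_E[OF S(1,1)] ij(3) by simp
    then show "i = j" using E_E[OF S(1,2)] S(3) by metis
  qed
  have "(\<lambda>e. e) \<in> E ` S \<rightarrow> carrier R" by (auto simp: S_def)
  from finsum_reindex[OF this inj] have "(\<Oplus>e\<in>E ` S. e) = (\<Oplus>i\<in>S. E i)" by simp
  also have "\<dots> = (\<Oplus>i\<in>residue_seqs n. E i)"
    by (rule add.finprod_mono_neutral_cong_left) (auto simp: S_def)
  finally have "(\<Oplus>e\<in>E ` S. e) = \<one>" using E_sum by simp
  moreover have "pairwise (orthogonal_elems R) (E ` S)"
    unfolding pairwise_def orthogonal_elems_def
    by (auto simp: S_def E_E)
  moreover have "\<forall>e\<in>E ` S. primitive_idempotent R e"
    using primitive_E by (auto simp: S_def)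
  ultimately show ?thesis
    unfolding set complete_primitive_orthogonal_idempotents_def by (auto simp: S_def)
qed

end

subsection \<open>The free algebra\<close>

lemma klr_free_induct [consumes 1, case_names zero single add]:
  assumes "p \<in> carrier (klr_free K n)" "Q 0"
    and single: "\<And>w c. set (letters w) \<subseteq> klr_gens n \<Longrightarrow> Q (Poly_Mapping.single w c)"
    and add: "\<And>p q. \<lbrakk>p \<in> carrier (klr_free K n); q \<in> carrier (klr_free K n); Q p; Q q\<rbrakk> \<Longrightarrow> Q (p + q)"
  shows "Q p"
  using assms(1)
proof (induction p rule: update_induct)
  case const
  show ?case by (rule assms(2))
next
  case (update f w c)
  have "Poly_Mapping.update w c f = Poly_Mapping.single w c + f"
    using update.hyps
    by (intro poly_mapping_eqI)
      (auto simp: lookup_update lookup_add lookup_single when_def in_keys_iff split: if_splits)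
  moreover have "Poly_Mapping.keys (Poly_Mapping.update w c f) = insert w (Poly_Mapping.keys f)"
    using update.hyps by (auto simp: in_keys_iff lookup_update split: if_splits)
  ultimately show ?case
    using update by (auto simp: klr_free_def intro!: add single split: if_splits)
qed

lemma single_in_klr_free:
  "set (letters w) \<subseteq> klr_gens n \<Longrightarrow> Poly_Mapping.single w c \<in> carrier (klr_free K n)"
  by (auto simp: klr_free_def split: if_splits)

lemma gen_in_klr_free: "g \<in> klr_gens n \<Longrightarrow> gen g \<in> carrier (klr_free K n)"
  unfolding gen_def by (rule single_in_klr_free) simp

lemma klr_free_diff_closed:
  assumes "p \<in> carrier (klr_free K n)" "q \<in> carrier (klr_free K n)"
  shows "p - q \<in> carrier (klr_free K n)"
  using klr_free_add_closed[OF assms(1) klr_free_uminus_closed[OF assms(2)]] by simp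

lemma klr_free_zero_one_closed:
  "0 \<in> carrier (klr_free K n)" "1 \<in> carrier (klr_free K n)"
  by (auto simp: klr_free_def zero_klr_word_def)

lemma klr_free_sum_closed:
  assumes "\<And>x. x \<in> A \<Longrightarrow> f x \<in> carrier (klr_free K n)"
  shows "sum f A \<in> carrier (klr_free K n)"
  using assms
  by (induction A rule: infinite_finite_induct)
    (simp_all add: klr_free_zero_one_closed klr_free_add_closed)

lemma fe_in_klr_free: "i \<in> residue_seqs n \<Longrightarrow> fe i \<in> carrier (klr_free K n)"
  and fy_in_klr_free: "k \<in> {1..n} \<Longrightarrow> fy k \<in> carrier (klr_free K n)"
  and fpsi_in_klr_free: "k \<in> {1..n - 1} \<Longrightarrow> fpsi k \<in> carrier (klr_free K n)"
  by (rule gen_in_klr_free; force simp: klr_gens_def)+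

lemmas klr_free_closed = fe_in_klr_free fy_in_klr_free fpsi_in_klr_free klr_free_mult_closed
  klr_free_diff_closed klr_free_zero_one_closed klr_free_sum_closed klr_free_add_closed

lemma klr_rels_subset: "klr_rels n \<subseteq> carrier (klr_free K n)"
proof
  fix r :: "'a free_elem" assume "r \<in> klr_rels n"
  then show "r \<in> carrier (klr_free K n)"
    by (induction rule: klr_rels.induct)
      (auto intro!: klr_free_closed swap_in_residue_seqs)
qed

subsection \<open>A representation on the growing sequences\<close>

text \<open>Every generator sends a basis vector to a basis vector or to 0, encoded as
  \<open>None\<close>. Killing adjacent swaps fits the quadratic relations, whose right sides vanish
  there along with the y's.\<close>

fun gen_act :: "nat \<Rightarrow> klr_gen \<Rightarrow> nat list \<Rightarrow> nat list option" where
  "gen_act n (GenE i) j = (if i = j then Some j else None)"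
| "gen_act n (GenY k) j = None"
| "gen_act n (GenPsi k) j =
    (if adj n (entry j k) (entry j (k + 1)) then None else Some (swap_entries k j))"

text \<open>The rightmost letter acts first, which gives a left module.\<close>

definition word_act :: "nat \<Rightarrow> klr_word \<Rightarrow> nat list \<Rightarrow> nat list option" where
  "word_act n w j = foldr (\<lambda>g s. Option.bind s (gen_act n g)) (letters w) (Some j)"

lemma word_act_add: "word_act n (u + v) j = Option.bind (word_act n v j) (word_act n u)"
proof -
  have "foldr (\<lambda>g s. Option.bind s (gen_act n g)) gs None = None" for gs
    by (induction gs) auto
  then show ?thesis by (cases "word_act n v j") (auto simp: word_act_def plus_klr_word_def)
qed

abbreviation growing_seqs :: "nat \<Rightarrow> nat list set" where
  "growing_seqs n \<equiv> {i \<in> residue_seqs n. growing n i}"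

lemma word_act_growing:
  assumes "set (letters w) \<subseteq> klr_gens n" "j \<in> growing_seqs n" "word_act n w j = Some i"
  shows "i \<in> growing_seqs n"
proof -
  have "foldr (\<lambda>g s. Option.bind s (gen_act n g)) gs (Some j) = Some i \<Longrightarrow> i \<in> growing_seqs n"
    if "set gs \<subseteq> klr_gens n" for gs
    using that
  proof (induction gs arbitrary: i)
    case Nil
    then show ?case using assms(2) by simp
  next
    case (Cons g gs)
    then obtain l where l: "l \<in> growing_seqs n" "gen_act n g l = Some i"
      by (auto simp: bind_eq_Some_conv)
    have "g \<in> klr_gens n" using Cons.prems by simp
    then show ?case
      using l by (auto simp: klr_gens_def swap_in_residue_seqs growing_swap split: if_splits)
  qed
  then show ?thesis using assms by (simp add: word_act_def)
qed

text \<open>The coefficient of the basis vector \<open>i\<close> in \<open>p\<close> applied to the basis vector \<open>j\<close>.\<close>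

definition act_coeff :: "nat \<Rightarrow> 'k::field free_elem \<Rightarrow> nat list \<Rightarrow> nat list \<Rightarrow> 'k" where
  "act_coeff n p j i =
    (\<Sum>w\<in>Poly_Mapping.keys p. if word_act n w j = Some i then Poly_Mapping.lookup p w else 0)"

lemma act_coeff_superset:
  assumes "finite A" "Poly_Mapping.keys p \<subseteq> A"
  shows "act_coeff n p j i
    = (\<Sum>w\<in>A. if word_act n w j = Some i then Poly_Mapping.lookup p w else 0)"
  unfolding act_coeff_def
  by (rule sum.mono_neutral_left) (use assms in \<open>auto simp: in_keys_iff\<close>)

lemma act_coeff_add: "act_coeff n (p + q) j i = act_coeff n p j i + act_coeff n q j i"
proof -
  let ?A = "Poly_Mapping.keys p \<union> Poly_Mapping.keys q"
  show ?thesis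
    using Poly_Mapping.keys_add[of p q]
    by (simp add: act_coeff_superset[of ?A] sum.distrib[symmetric])
      (rule sum.cong, auto simp: lookup_add)
qed

lemma act_coeff_zero [simp]: "act_coeff n 0 j i = 0"
  by (simp add: act_coeff_def)

lemma act_coeff_diff: "act_coeff n (p - q) j i = act_coeff n p j i - act_coeff n q j i"
  using act_coeff_add[of n "p - q" q j i] by simp

lemma act_coeff_sum: "act_coeff n (sum f A) j i = (\<Sum>x\<in>A. act_coeff n (f x) j i)"
  by (induction A rule: infinite_finite_induct) (simp_all add: act_coeff_add)

lemma act_coeff_single:
  "act_coeff n (Poly_Mapping.single w c) j i = (if word_act n w j = Some i then c else 0)"
  by (simp add: act_coeff_def)

text \<open>Matrix multiplication. By \<open>word_act_growing\<close>, words send a growing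
  \<open>j\<close> into the growing sequences, so the middle index may range over these
  alone.\<close>

lemma act_coeff_mult:
  assumes "p \<in> carrier (klr_free K n)" "q \<in> carrier (klr_free K n)" "j \<in> growing_seqs n"
  shows "act_coeff n (p * q) j i = (\<Sum>l\<in>growing_seqs n. act_coeff n q j l * act_coeff n p l i)"
  using assms(1)
proof (induction rule: klr_free_induct)
  case (single u a)
  show ?case
    using assms(2)
  proof (induction rule: klr_free_induct)
    case (single v b)
    show ?case
    proof (cases "word_act n v j")
      case None
      then show ?thesis by (simp add: mult_single act_coeff_single word_act_add)
    next
      case (Some l)
      then have "l \<in> growing_seqs n" using word_act_growing[OF single assms(3)] by simp
      then have "(\<Sum>m\<in>growing_seqs n. (if l = m then b else 0) * (if word_act n u m = Some i then a else 0))
          = b * (if word_act n u l = Some i then a else 0)"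
        by (simp add: if_distrib[of "\<lambda>x. x * _"] sum.delta cong: if_cong)
      then show ?thesis
        using Some by (simp add: mult_single act_coeff_single word_act_add)
    qed
  qed (simp_all add: distrib_left distrib_right act_coeff_add sum.distrib)
qed (simp_all add: distrib_left distrib_right act_coeff_add sum.distrib)

text \<open>The annihilator of the module. Once it contains the defining relations and the
  cyclotomic generators, anything acting nontrivially survives in the quotient.\<close>

definition act_kernel :: "'k::field itself \<Rightarrow> nat \<Rightarrow> 'k free_elem set" where
  "act_kernel K n = {p \<in> carrier (klr_free K n). \<forall>j\<in>growing_seqs n. \<forall>i. act_coeff n p j i = 0}"

lemma ideal_act_kernel: "ideal (act_kernel K n) (klr_free K n)"
proof (rule idealI)
  show "ring (klr_free K n)" by (rule ring_klr_free)
  interpret F: ring "klr_free K n" by (rule ring_klr_free)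
  show "subgroup (act_kernel K n) (add_monoid (klr_free K n))"
  proof (rule F.add.subgroupI)
    show "act_kernel K n \<subseteq> carrier (klr_free K n)" by (auto simp: act_kernel_def)
    have "0 \<in> act_kernel K n" by (simp add: act_kernel_def klr_free_closed)
    then show "act_kernel K n \<noteq> {}" by blast
  next
    fix p assume p: "p \<in> act_kernel K n"
    then have "\<ominus>\<^bsub>klr_free K n\<^esub> p = - p"
      by (intro F.minus_equality) (auto simp: act_kernel_def klr_free_uminus_closed)
    moreover have "- p \<in> act_kernel K n"
      using p act_coeff_diff[of n 0 p] by (auto simp: act_kernel_def klr_free_uminus_closed)
    ultimately show "\<ominus>\<^bsub>klr_free K n\<^esub> p \<in> act_kernel K n" by simp
  next
    fix p q assume "p \<in> act_kernel K n" "q \<in> act_kernel K n"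
    then show "p \<oplus>\<^bsub>klr_free K n\<^esub> q \<in> act_kernel K n"
      by (auto simp: act_kernel_def klr_free_add_closed act_coeff_add)
  qed
next
  fix p q assume pq: "p \<in> act_kernel K n" "q \<in> carrier (klr_free K n)"
  then show "q \<otimes>\<^bsub>klr_free K n\<^esub> p \<in> act_kernel K n" "p \<otimes>\<^bsub>klr_free K n\<^esub> q \<in> act_kernel K n"
    by (auto simp: act_kernel_def klr_free_mult_closed act_coeff_mult[of _ K])
qed

lemmas coeff_simps = gen_def left_diff_distrib right_diff_distrib mult_single plus_klr_word_def
  act_coeff_diff act_coeff_single word_act_def

lemma bind_Y_act [simp]: "Option.bind s (gen_act n (GenY k)) = None"
  by (cases s) auto

context
  fixes n k :: nat and j :: "nat list"
  assumes j: "j \<in> residue_seqs n" and k: "k \<in> {1..n - 1}"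
begin

lemma psi_act_E:
  assumes "i \<in> residue_seqs n"
  shows "Option.bind (gen_act n (GenPsi k) j) (gen_act n (GenE (swap_entries k i)))
    = (if i = j then gen_act n (GenPsi k) j else None)"
  using swap_swap[OF j k] swap_swap[OF assms k] by auto

lemma psi_act_commute:
  assumes l: "l \<in> {1..n - 1}" and kl: "\<bar>int k - int l\<bar> > 1"
  shows "Option.bind (gen_act n (GenPsi l) j) (gen_act n (GenPsi k))
    = Option.bind (gen_act n (GenPsi k) j) (gen_act n (GenPsi l))"
proof -
  have "l \<noteq> k" "l \<noteq> k + 1" "l + 1 \<noteq> k" using kl by auto
  moreover have "k \<in> {1..n}" "k + 1 \<in> {1..n}" "l \<in> {1..n}" "l + 1 \<in> {1..n}" using k l by auto
  ultimately show ?thesis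
    using entry_swap[OF j k] entry_swap[OF j l] swap_commute[OF j k l kl] by simp
qed

text \<open>Both sides test the same three pairs of entries for adjacency, in opposite orders, so
  they vanish together.\<close>

lemma psi_act_braid:
  assumes k1: "k + 1 \<in> {1..n - 1}"
  shows "Option.bind (Option.bind (gen_act n (GenPsi k) j) (gen_act n (GenPsi (k + 1)))) (gen_act n (GenPsi k))
    = Option.bind (Option.bind (gen_act n (GenPsi (k + 1)) j) (gen_act n (GenPsi k)))
        (gen_act n (GenPsi (k + 1)))"
proof -
  have "k \<in> {1..n}" "k + 1 \<in> {1..n}" "k + 2 \<in> {1..n}" using k k1 by auto
  then show ?thesis
    using entry_swap[OF j k] entry_swap[OF j k1] swap_braid[OF j k k1]
      entry_swap[OF swap_in_residue_seqs[OF j k] k1] entry_swap[OF swap_in_residue_seqs[OF j k1] k]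
    by simp
qed

lemma psi_act_sq:
  "\<not> adj n (entry j k) (entry j (k + 1)) \<Longrightarrow>
    Option.bind (gen_act n (GenPsi k) j) (gen_act n (GenPsi k)) = Some j"
proof -
  have "k \<in> {1..n}" "k + 1 \<in> {1..n}" using k by auto
  then show "\<not> adj n (entry j k) (entry j (k + 1)) \<Longrightarrow>
      Option.bind (gen_act n (GenPsi k) j) (gen_act n (GenPsi k)) = Some j"
    using entry_swap[OF j k] swap_swap[OF j k] by (simp add: adj_sym)
qed

end

lemma klr_rels_act_kernel: "klr_rels n \<subseteq> act_kernel K n"
proof
  fix r :: "'a free_elem" assume r: "r \<in> klr_rels n"
  \<comment> \<open>The KLR relations already hold on the span of all residue sequences; growth
    matters for the cyclotomic generators.\<close>
  have "act_coeff n r j i = 0" if j: "j \<in> residue_seqs n" for i j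
    using r
  proof cases
    case e_sum
    have "act_coeff n (\<Sum>l\<in>residue_seqs n. fe l) j i
      = (\<Sum>l\<in>residue_seqs n. if l = j then if j = i then 1 else 0 else (0::'a))"
      unfolding act_coeff_sum
      by (rule sum.cong) (auto simp: gen_def act_coeff_single word_act_def)
    moreover have "act_coeff n (1::'a free_elem) j i = (if j = i then 1 else 0)"
      unfolding single_one[symmetric] act_coeff_single by (simp add: word_act_def zero_klr_word_def)
    ultimately show ?thesis using that by (simp add: e_sum act_coeff_diff)
  next
    case (psi_e k l)
    then show ?thesis
      using psi_act_E[OF j, of k l] by (auto simp: coeff_simps simp del: gen_act.simps(3))
  next
    case (psi_psi k l)
    then show ?thesis
      using psi_act_commute[OF j, of k l] by (auto simp: coeff_simps simp del: gen_act.simps(3))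
  next
    case (braid k l)
    then show ?thesis
      using psi_act_braid[OF j, of k] by (auto simp: coeff_simps simp del: gen_act.simps(3))
  next
    case (psi_sq_none k l)
    then show ?thesis
      using psi_act_sq[OF j, of k] by (auto simp: coeff_simps adj_def simp del: gen_act.simps(3))
  \<comment> \<open>Apart from the orthogonality of the idempotents, the remaining relations have
    both sides acting as 0: a y occurs, or \<psi>_k meets adjacent entries.\<close>
  qed (use j in \<open>auto simp: coeff_simps adj_def\<close>)
  then show "r \<in> act_kernel K n"
    using r klr_rels_subset[of n K] by (auto simp: act_kernel_def)
qed

subsection \<open>The cyclotomic quotient of the free algebra\<close>

lemma ideal_klr_ideal: "ideal (klr_ideal K n) (klr_free K n)"
  unfolding klr_ideal_def by (rule ring.genideal_ideal[OF ring_klr_free klr_rels_subset])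

lemma ring_klr: "ring (klr K n)"
  unfolding klr_def by (rule ideal.quotient_is_ring[OF ideal_klr_ideal])

lemma klr_class_ring_hom: "klr_class K n \<in> ring_hom (klr_free K n) (klr K n)"
proof -
  have "klr_class K n = (+>\<^bsub>klr_free K n\<^esub>) (klr_ideal K n)" by (auto simp: klr_class_def)
  then show ?thesis
    unfolding klr_def using ideal.rcos_ring_hom[OF ideal_klr_ideal] by simp
qed

lemma klr_class_closed: "p \<in> carrier (klr_free K n) \<Longrightarrow> klr_class K n p \<in> carrier (klr K n)"
  by (rule ring_hom_closed[OF klr_class_ring_hom])

lemma zero_klr: "\<zero>\<^bsub>klr K n\<^esub> = klr_ideal K n"
  by (simp add: klr_def FactRing_def)

text \<open>Lifts of the cyclotomic generators to the free algebra, where they can be tested on the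
  module.\<close>

definition cyc_gens :: "'k::field itself \<Rightarrow> nat \<Rightarrow> 'k free_elem set" where
  "cyc_gens K n = {fy 1 * fe i | i. i \<in> residue_seqs n \<and> entry i 1 = 0} \<union>
    {fe i | i. i \<in> residue_seqs n \<and> entry i 1 \<noteq> 0}"

lemma cyc_gens_subset: "n > 1 \<Longrightarrow> cyc_gens K n \<subseteq> carrier (klr_free K n)"
  by (auto simp: cyc_gens_def intro!: klr_free_closed)

lemma cyc_ideal_eq:
  assumes "n > 1"
  shows "cyc_ideal K n = Idl\<^bsub>klr K n\<^esub> (klr_class K n ` cyc_gens K n)"
proof -
  have "klr_y K n 1 \<otimes>\<^bsub>klr K n\<^esub> klr_e K n i = klr_class K n (fy 1 * fe i)"
    if "i \<in> residue_seqs n" for i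
    unfolding klr_y_def klr_e_def
    using ring_hom_mult[OF klr_class_ring_hom, of "fy 1" K n "fe i"] that assms
    by (simp add: fe_in_klr_free fy_in_klr_free)
  then have "{klr_y K n 1 \<otimes>\<^bsub>klr K n\<^esub> klr_e K n i | i. i \<in> residue_seqs n \<and> entry i 1 = 0} \<union>
      {klr_e K n i | i. i \<in> residue_seqs n \<and> entry i 1 \<noteq> 0} = klr_class K n ` cyc_gens K n"
    unfolding cyc_gens_def klr_e_def by (auto simp: image_iff; metis)
  then show ?thesis by (simp add: cyc_ideal_def)
qed

lemma ideal_cyc_ideal:
  assumes "n > 1"
  shows "ideal (cyc_ideal K n) (klr K n)"
  unfolding cyc_ideal_eq[OF assms]
  by (rule ring.genideal_ideal[OF ring_klr]) (use cyc_gens_subset[OF assms] klr_class_closed in blast)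

lemma ring_cyc_klr: "n > 1 \<Longrightarrow> ring (cyc_klr K n)"
  unfolding cyc_klr_def by (rule ideal.quotient_is_ring[OF ideal_cyc_ideal])

definition cyc_class :: "'k::field itself \<Rightarrow> nat \<Rightarrow> 'k free_elem \<Rightarrow> 'k free_elem set set" where
  "cyc_class K n p = cyc_ideal K n +>\<^bsub>klr K n\<^esub> klr_class K n p"

lemma cyc_e_eq: "cyc_e K n i = cyc_class K n (fe i)"
  by (simp add: cyc_e_def klr_e_def cyc_class_def)

lemma zero_cyc_klr: "\<zero>\<^bsub>cyc_klr K n\<^esub> = cyc_ideal K n"
  by (simp add: cyc_klr_def FactRing_def)

lemma cyc_class_ring_hom:
  assumes "n > 1"
  shows "cyc_class K n \<in> ring_hom (klr_free K n) (cyc_klr K n)"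
proof -
  have "cyc_class K n = (+>\<^bsub>klr K n\<^esub>) (cyc_ideal K n) \<circ> klr_class K n"
    by (auto simp: cyc_class_def)
  then show ?thesis
    unfolding cyc_klr_def
    using ring_hom_trans[OF klr_class_ring_hom ideal.rcos_ring_hom[OF ideal_cyc_ideal[OF assms]]]
    by simp
qed

lemma cyc_class_surj:
  assumes "x \<in> carrier (cyc_klr K n)"
  shows "\<exists>p\<in>carrier (klr_free K n). x = cyc_class K n p"
  using assms
  by (auto simp: cyc_klr_def klr_def FactRing_def A_RCOSETS_def' cyc_class_def klr_class_def)

lemma cyc_class_eq_zeroI:
  assumes "n > 1" "klr_class K n p \<in> cyc_ideal K n"
  shows "cyc_class K n p = \<zero>\<^bsub>cyc_klr K n\<^esub>"
proof -
  interpret ideal "cyc_ideal K n" "klr K n" by (rule ideal_cyc_ideal[OF assms(1)])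
  show ?thesis unfolding cyc_class_def zero_cyc_klr by (rule a_rcos_const[OF assms(2)])
qed

lemma klr_class_rel:
  assumes "r \<in> klr_rels n"
  shows "klr_class K n r = \<zero>\<^bsub>klr K n\<^esub>"
proof -
  interpret ideal "klr_ideal K n" "klr_free K n" by (rule ideal_klr_ideal)
  have "r \<in> klr_ideal K n"
    using ring.genideal_self[OF ring_klr_free klr_rels_subset] assms unfolding klr_ideal_def by blast
  then show ?thesis unfolding klr_class_def zero_klr by (rule a_rcos_const)
qed

lemma cyc_class_rel:
  assumes "n > 1" "r \<in> klr_rels n"
  shows "cyc_class K n r = \<zero>\<^bsub>cyc_klr K n\<^esub>"
proof (rule cyc_class_eq_zeroI[OF assms(1)])
  interpret ideal "cyc_ideal K n" "klr K n" by (rule ideal_cyc_ideal[OF assms(1)])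
  show "klr_class K n r \<in> cyc_ideal K n" unfolding klr_class_rel[OF assms(2)] by simp
qed

lemma cyc_class_gen:
  assumes "n > 1" "r \<in> cyc_gens K n"
  shows "cyc_class K n r = \<zero>\<^bsub>cyc_klr K n\<^esub>"
proof (rule cyc_class_eq_zeroI[OF assms(1)])
  have "klr_class K n ` cyc_gens K n \<subseteq> carrier (klr K n)"
    using cyc_gens_subset[OF assms(1)] klr_class_closed by blast
  then show "klr_class K n r \<in> cyc_ideal K n"
    using ring.genideal_self[OF ring_klr] assms(2) unfolding cyc_ideal_eq[OF assms(1)] by blast
qed

section \<open>Nonvanishing of e(i) for growing i\<close>

text \<open>If e(i) were zero, its lift would lie in the annihilator of the module, yet it fixes the
  basis vector i.\<close>

lemma cyc_e_nonzero:
  assumes "n > 1" "i \<in> residue_seqs n" "growing n i"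
  shows "cyc_e K n i \<noteq> \<zero>\<^bsub>cyc_klr K n\<^esub>"
proof
  assume zero: "cyc_e K n i = \<zero>\<^bsub>cyc_klr K n\<^esub>"
  have klr_sub: "klr_ideal K n \<subseteq> act_kernel K n"
    unfolding klr_ideal_def
    by (rule ring.genideal_minimal[OF ring_klr_free ideal_act_kernel klr_rels_act_kernel])
  have "cyc_gens K n \<subseteq> act_kernel K n"
  proof -
    have "act_coeff n (fy 1 * fe j :: 'a free_elem) l m = 0" for j l m
      by (simp add: coeff_simps)
    moreover have "act_coeff n (fe j :: 'a free_elem) l m = 0"
      if "entry j 1 \<noteq> 0" "l \<in> growing_seqs n" for j l m
      using that growing_iff_entry by (auto simp: coeff_simps)
    ultimately show ?thesis
      using cyc_gens_subset[OF assms(1), of K] unfolding cyc_gens_def act_kernel_def by auto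
  qed
  \<comment> \<open>The quotient is taken in two stages, so the annihilator is pushed to the
    intermediate ring; its image is an ideal there that contains the cyclotomic ideal.\<close>
  moreover have "ideal (klr_class K n ` act_kernel K n) (klr K n)"
  proof -
    have "klr_class K n = (+>\<^bsub>klr_free K n\<^esub>) (klr_ideal K n)" by (auto simp: klr_class_def)
    then show ?thesis
      unfolding klr_def
      using ring.ring_ideal_imp_quot_ideal[OF ring_klr_free ideal_klr_ideal ideal_act_kernel] by metis
  qed
  ultimately have cyc_sub: "cyc_ideal K n \<subseteq> klr_class K n ` act_kernel K n"
    unfolding cyc_ideal_eq[OF assms(1)]
    by (intro ring.genideal_minimal[OF ring_klr]) auto
  have fe: "fe i \<in> carrier (klr_free K n)" by (rule fe_in_klr_free[OF assms(2)])
  have "klr_class K n (fe i) \<in> cyc_ideal K n"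
    using zero ideal.rcos_const_imp_mem[OF ideal_cyc_ideal[OF assms(1)] klr_class_closed[OF fe]]
    unfolding cyc_e_eq cyc_class_def zero_cyc_klr by simp
  with cyc_sub obtain p where p: "p \<in> act_kernel K n" "klr_class K n (fe i) = klr_class K n p" by blast
  interpret I: ideal "klr_ideal K n" "klr_free K n" by (rule ideal_klr_ideal)
  \<comment> \<open>Back in the free algebra, the lift differs from p by an element of the KLR
    ideal, which annihilates the module as well.\<close>
  have "fe i \<in> klr_class K n p"
    using I.a_rcos_self[OF fe] p(2) by (simp add: klr_class_def)
  then obtain h where "h \<in> klr_ideal K n" "fe i = h + p"
    by (auto simp: klr_class_def a_r_coset_def')
  then have "(fe i :: 'a free_elem) \<in> act_kernel K n"
    using klr_sub p(1) by (auto simp: act_kernel_def act_coeff_add klr_free_add_closed)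
  moreover have "act_coeff n (fe i :: 'a free_elem) i i = 1" by (simp add: coeff_simps)
  ultimately show False using assms by (auto simp: act_kernel_def)
qed

section \<open>The quotient satisfies the abstract presentation\<close>

lemma cyclotomic_klr_cyc_klr:
  fixes K :: "'k::field itself"
  assumes n: "n > 1"
  shows "cyclotomic_klr (cyc_klr K n) n (cyc_e K n) (\<lambda>k. cyc_class K n (fy k))
    (\<lambda>k. cyc_class K n (fpsi k)) (\<lambda>c. cyc_class K n (Poly_Mapping.single 0 c))"
proof -
  let ?F = "klr_free K n" and ?R = "cyc_klr K n"
  interpret F: ring ?F by (rule ring_klr_free)
  interpret R: ring ?R by (rule ring_cyc_klr[OF n])
  interpret h: ring_hom_ring ?F ?R "cyc_class K n"
    by (rule ring_hom_ringI2[OF F.ring_axioms R.ring_axioms cyc_class_ring_hom[OF n]])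
  have h_mult: "cyc_class K n (p * q) = cyc_class K n p \<otimes>\<^bsub>?R\<^esub> cyc_class K n q"
    and h_add: "cyc_class K n (p + q) = cyc_class K n p \<oplus>\<^bsub>?R\<^esub> cyc_class K n q"
    if "p \<in> carrier ?F" "q \<in> carrier ?F" for p q
    using h.hom_mult[OF that] h.hom_add[OF that] by simp_all
  have h_zero: "cyc_class K n 0 = \<zero>\<^bsub>?R\<^esub>" and h_one: "cyc_class K n 1 = \<one>\<^bsub>?R\<^esub>"
    using h.hom_zero h.hom_one by simp_all
  have h_diff: "cyc_class K n (p - q) = cyc_class K n p \<ominus>\<^bsub>?R\<^esub> cyc_class K n q"
    if pq: "p \<in> carrier ?F" "q \<in> carrier ?F" for p q
  proof -
    have "\<ominus>\<^bsub>?F\<^esub> q = - q"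
      using pq by (intro F.minus_equality) (auto simp: klr_free_uminus_closed)
    then have "cyc_class K n (- q) = \<ominus>\<^bsub>?R\<^esub> cyc_class K n q" using h.hom_a_inv[OF pq(2)] by simp
    then show ?thesis
      using h_add[OF pq(1) klr_free_uminus_closed[OF pq(2)]] by (simp add: a_minus_def)
  qed
  have rel: "cyc_class K n p = cyc_class K n q"
    if "p - q \<in> klr_rels n" "p \<in> carrier ?F" "q \<in> carrier ?F" for p q
    by (rule R.minus_eq_zero_imp_eq[OF h.hom_closed[OF that(2)] h.hom_closed[OF that(3)]
        trans[OF h_diff[OF that(2,3), symmetric] cyc_class_rel[OF n that(1)]]])
  \<comment> \<open>The additive unit 0 of words is the empty word, so these elements are the
    scalars.\<close>
  have const: "Poly_Mapping.single 0 c \<in> carrier ?F" for c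
    by (rule single_in_klr_free) (simp add: zero_klr_word_def)
  have const_comm: "Poly_Mapping.single 0 c * gen g = gen g * Poly_Mapping.single 0 c"
    for c :: 'k and g by (simp add: gen_def mult_single)
  note closed = fe_in_klr_free fy_in_klr_free fpsi_in_klr_free klr_free_mult_closed
    klr_free_diff_closed klr_free_zero_one_closed swap_in_residue_seqs const
  have carr: "cyc_class K n p \<in> carrier ?R" if "p \<in> carrier ?F" for p
    using that by simp
  have up: "k \<in> {1..n}" "k + 1 \<in> {1..n}" if "k \<in> {1..n - 1}" for k
    using that by auto
  show ?thesis
    unfolding cyc_e_eq
  proof (intro cyclotomic_klr.intro cyclotomic_klr_axioms.intro, goal_cases)
    case 1 show ?case by (rule R.ring_axioms)
  next
    case 2 show ?case by (rule n)
  next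
    case (3 i) then show ?case by (intro carr closed)
  next
    case (4 k) then show ?case by (intro carr closed)
  next
    case (5 k) then show ?case by (intro carr closed)
  next
    case (6 c) show ?case by (intro carr closed)
  next
    case (7 c d) show ?case by (simp add: single_add h_add const)
  next
    case (8 c d) show ?case by (simp add: h_mult[OF const const, symmetric] mult_single)
  next
    case 9 show ?case by (simp add: h_one)
  next
    case (10 i c) then show ?case
      by (simp add: h_mult[symmetric] closed const_comm)
  next
    case (11 k c) then show ?case
      by (simp add: h_mult[symmetric] closed const_comm)
  next
    case (12 k c) then show ?case
      by (simp add: h_mult[symmetric] closed const_comm)
  next
    case (13 S)
    note S = 13
    \<comment> \<open>Generation: words are built letter by letter from the left, starting at 1;
      scalars and sums then give all elements of the free algebra, which maps onto the
      quotient.\<close>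
    have word: "cyc_class K n (Poly_Mapping.single (Word gs) 1) \<in> S" if "set gs \<subseteq> klr_gens n" for gs
      using that
    proof (induction gs)
      case Nil
      then show ?case using S(2) h_one by (simp add: zero_klr_word_def[symmetric])
    next
      case (Cons g gs)
      have g: "g \<in> klr_gens n" and gs: "set gs \<subseteq> klr_gens n" using Cons.prems by auto
      have "Poly_Mapping.single (Word (g # gs)) (1::'k) = gen g * Poly_Mapping.single (Word gs) 1"
        by (simp add: gen_def mult_single plus_klr_word_def)
      then have "cyc_class K n (Poly_Mapping.single (Word (g # gs)) 1)
          = cyc_class K n (gen g) \<otimes>\<^bsub>?R\<^esub> cyc_class K n (Poly_Mapping.single (Word gs) 1)"
        using h_mult[OF gen_in_klr_free[OF g] single_in_klr_free[of "Word gs" n 1 K]] gs by simp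
      moreover have "cyc_class K n (gen g) \<otimes>\<^bsub>?R\<^esub> z \<in> S" if "z \<in> S" for z
        using g S(5-7) that unfolding klr_gens_def by auto
      ultimately show ?case using Cons.IH[OF gs] by simp
    qed
    have "cyc_class K n p \<in> S" if "p \<in> carrier ?F" for p
      using that
    proof (induction rule: klr_free_induct)
      case zero
      have "cyc_class K n (Poly_Mapping.single 0 0) \<otimes>\<^bsub>?R\<^esub> \<one>\<^bsub>?R\<^esub> \<in> S" by (rule S(4)[OF S(2)])
      then show ?case using h_zero by simp
    next
      case (single w c)
      have "Poly_Mapping.single w c = Poly_Mapping.single 0 c * Poly_Mapping.single w (1::'k)"
        by (simp add: mult_single)
      then have "cyc_class K n (Poly_Mapping.single w c)
          = cyc_class K n (Poly_Mapping.single 0 c) \<otimes>\<^bsub>?R\<^esub> cyc_class K n (Poly_Mapping.single w 1)"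
        using h_mult[OF const single_in_klr_free[OF single]] by simp
      then show ?case using S(4)[OF word, of "letters w" c] single by simp
    next
      case (add p q)
      then show ?case using S(3) by (simp add: h_add)
    qed
    then show ?case using cyc_class_surj by blast
  next
    case (14 i j)
    then show ?case
      using rel[OF klr_rels.e_e[OF 14]] by (cases "i = j") (simp_all add: h_mult h_zero closed)
  next
    case 15
    have fin: "cyc_class K n (\<Sum>i\<in>A. fe i) = (\<Oplus>\<^bsub>?R\<^esub>i\<in>A. cyc_class K n (fe i))"
      if "finite A" "A \<subseteq> residue_seqs n" for A
      using that
    proof (induction A rule: finite_induct)
      case empty
      then show ?case by (simp add: h_zero)
    next
      case (insert i A)
      have "(\<Sum>i\<in>A. fe i) \<in> carrier ?F" "fe i \<in> carrier ?F"
        using insert.prems by (auto intro!: klr_free_sum_closed fe_in_klr_free)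
      moreover have "(\<lambda>i. cyc_class K n (fe i)) \<in> A \<rightarrow> carrier ?R"
        using insert.prems by (auto intro!: carr fe_in_klr_free)
      ultimately show ?case
        using insert by (simp add: h_add R.finsum_insert carr)
    qed
    show ?case
      using rel[OF klr_rels.e_sum] h_one klr_free_sum_closed[where A = "residue_seqs n" and f = fe and n = n and K = K]
      by (simp add: fin[symmetric] closed)
  next
    case (16 k i)
    then show ?case using rel[OF klr_rels.y_e[OF 16]] by (simp add: h_mult closed)
  next
    case (17 k i)
    then show ?case using rel[OF klr_rels.psi_e[OF 17]] by (simp add: h_mult closed)
  next
    case (18 k l)
    then show ?case using rel[OF klr_rels.y_y[OF 18]] by (simp add: h_mult closed)
  next
    case (19 k l)
    then show ?case using rel[OF klr_rels.psi_y[OF 19]] by (simp add: h_mult closed)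
  next
    case (20 k l)
    then show ?case using rel[OF klr_rels.psi_psi[OF 20]] by (simp add: h_mult closed)
  next
    case (21 k i)
    then show ?case using rel[OF klr_rels.psi_y_right[OF 21]] up[OF 21(1)] by (simp add: h_mult closed)
  next
    case (22 k i)
    then show ?case using rel[OF klr_rels.y_psi_right[OF 22]] up[OF 22(1)] by (simp add: h_mult closed)
  next
    case (23 k i)
    then show ?case using rel[OF klr_rels.braid[OF 23]] by (simp add: h_mult closed)
  next
    case (24 k i)
    then show ?case using rel[OF klr_rels.psi_sq_none[OF 24]] by (simp add: h_mult closed)
  next
    case (25 k i)
    then show ?case using rel[OF klr_rels.psi_sq_right[OF 25]] up[OF 25(1)]
      by (simp add: h_mult h_diff closed)
  next
    case (26 k i)
    then show ?case using rel[OF klr_rels.psi_sq_left[OF 26]] up[OF 26(1)]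
      by (simp add: h_mult h_diff closed)
  next
    case (27 k i)
    then show ?case using rel[OF klr_rels.psi_sq_both[OF 27]] up[OF 27(1)]
      by (simp add: h_mult h_diff closed)
  next
    case (28 i)
    then have "cyc_class K n (fy 1 * fe i) = \<zero>\<^bsub>?R\<^esub>"
      by (intro cyc_class_gen[OF n]) (auto simp: cyc_gens_def)
    then show ?case using n 28 by (simp add: h_mult closed)
  next
    case (29 i)
    then show ?case by (intro cyc_class_gen[OF n]) (auto simp: cyc_gens_def)
  qed
qed

theorem theorem3:
  fixes K :: "'k::field itself" and n :: nat
  assumes "n > 1"
  shows "card {i \<in> residue_seqs n. cyc_e K n i \<noteq> \<zero>\<^bsub>cyc_klr K n\<^esub>} = 2 ^ (n - 2)
    \<and> complete_primitive_orthogonal_idempotents (cyc_klr K n)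
        {cyc_e K n i | i. i \<in> residue_seqs n \<and> cyc_e K n i \<noteq> \<zero>\<^bsub>cyc_klr K n\<^esub>}"
proof -
  interpret cyclotomic_klr "cyc_klr K n" n "cyc_e K n" "\<lambda>k. cyc_class K n (fy k)"
    "\<lambda>k. cyc_class K n (fpsi k)" "\<lambda>c. cyc_class K n (Poly_Mapping.single 0 c)"
    by (rule cyclotomic_klr_cyc_klr[OF assms])
  \<comment> \<open>One inclusion comes from the relations, the other from the module.\<close>
  have "{i \<in> residue_seqs n. cyc_e K n i \<noteq> \<zero>\<^bsub>cyc_klr K n\<^esub>} = growing_seqs n"
    using E_eq_zero_if_not_growing cyc_e_nonzero[OF assms] by blast
  then show ?thesis
    using card_growing_residue_seqs[OF assms] complete_primitive_orthogonal by simp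
qed

end
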